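(* Let $\alpha=0$ and let $\mu$ be a delay distribution on $[0,1]$ with $\mathbb{P}(\xi=0)<1$ for $\xi\sim\mu$, such that $\eta=-\log(1-\xi)$ has a density $f_\eta$ on $[0,\infty)$ with $\sup_{u\ge0}e^uf_\eta(u)<\infty$, and such that Assumption (A) holds. Let $M(\rho,n)$ be the degree of the root $v_1$ in $\mathcal{T}(n)$. (a) (Upper bound) If $\mathbb{E}(e^{\gamma\eta})<\infty$ for all $\gamma>0$, there exists $C_1\in(0,\infty)$ such that for every $A>0$, $$\limsup_{n\to\infty}\mathbb{P}(M(\rho,n)>An^\lambda)\le \frac{C_1}{A^{1/(\lambda+1)}}.$$ (b) (Lower bound) If $\mathbb{E}(e^{\gamma\eta})<\infty$ for some $\gamma>1$, there exist finite positive constants $C_1,C_2$ such that for every $x>0$, $$\limsup_{n\to\infty}\mathbb{P}(M(\rho,n)<xn^\lambda)\le C_1x^{C_2}.$$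
   Context: Model ($\alpha=0$): $\mathcal{T}(1)$ is a single vertex $v_1$ (root); $\mathcal{T}(2)$ has vertices $v_1,v_2$ with $v_2$ a child of $v_1$; $\mathcal{T}(0):=\mathcal{T}(1)$. $\deg(v_i,j)$ is the degree of $v_i$ in $\mathcal{T}(j)$, with $\deg(v_i,i)=1$. For $n\ge2$, a new vertex $v_{n+1}$, with independent delay $\xi_{n+1}\sim\mu$, becomes a child of a vertex $v$ of $\mathcal{T}(\lfloor n-n\xi_{n+1}\rfloor)$ chosen with probability proportional to $\deg(v,\lfloor n-n\xi_{n+1}\rfloor)$. Let $F_\eta$ be the law of $\eta$ and $h(x)=\frac12\int_0^xe^udF_\eta(u)$. Let $\zeta_{\mathrm{e}}$ be a Poisson point process on $[0,\infty)$ with intensity $h(t)dt$ and $\hat\zeta_{\mathrm{e}}(s)=\int_0^\infty e^{-st}\zeta_{\mathrm{e}}(dt)$. Assumption (A): $\mathbb{E}(e^{\theta\eta})<\infty$ for some $\theta>0$; $\lambda>0$ is the unique solution of $\int_0^\infty e^{-\lambda t}h(t)dt=1$; and $\mathbb{E}(\hat\zeta_{\mathrm{e}}(\lambda)\log^+\hat\zeta_{\mathrm{e}}(\lambda))<\infty$. *)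

theory Defs
  imports "HOL-Probability.Probability"
begin

text \<open>Trees T(n) are encoded by parent lists ps of length n - 1 with vertices
  numbered 1..n: ps ! i is the parent of vertex v_(i+2), and ps ! i is in {1..i+1}.\<close>

definition tree_lists :: "nat \<Rightarrow> nat list set" where
  "tree_lists n = {ps. length ps = n - 1 \<and> (\<forall>i<length ps. 1 \<le> ps ! i \<and> ps ! i \<le> i + 1)}"

text \<open>Degree of vertex v in T(k) (k \<ge> 1), where T(k) is the prefix of the tree ps:
  1 plus its number of children, so that deg(v_i, i) = 1.\<close>
definition tdeg :: "nat list \<Rightarrow> nat \<Rightarrow> nat \<Rightarrow> nat" where
  "tdeg ps k v = 1 + count_list (take (k - 1) ps) v"

text \<open>Attachment probability: given T(n) (parent list ps), the probability that
  v_(n+1) becomes a child of v. For n \<ge> 2 the delay xi ~ mu selects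
  T(floor(n - n xi)), with T(0) = T(1), and v is chosen proportionally to its degree there.\<close>
definition trans_prob :: "real measure \<Rightarrow> nat \<Rightarrow> nat list \<Rightarrow> nat \<Rightarrow> real" where
  "trans_prob \<mu> n ps v =
     (if n = 1 then (if v = 1 then 1 else 0)
      else LINT \<xi>|\<mu>.
        (let k = max 1 (nat \<lfloor>real n - real n * \<xi>\<rfloor>) in
          if 1 \<le> v \<and> v \<le> k
          then real (tdeg ps k v) / (\<Sum>u = 1..k. real (tdeg ps k u))
          else 0))"

definition tree_prob :: "real measure \<Rightarrow> nat list \<Rightarrow> real" where
  "tree_prob \<mu> ps = (\<Prod>i<length ps. trans_prob \<mu> (i + 1) (take i ps) (ps ! i))"

definition tree_event_prob :: "real measure \<Rightarrow> nat \<Rightarrow> (nat list \<Rightarrow> bool) \<Rightarrow> real" where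
  "tree_event_prob \<mu> n P = (\<Sum>ps\<in>tree_lists n. if P ps then tree_prob \<mu> ps else 0)"

definition root_deg :: "nat list \<Rightarrow> nat" where
  "root_deg ps = tdeg ps (length ps + 1) 1"

definition eta_of :: "real \<Rightarrow> real" where
  "eta_of \<xi> = - ln (1 - \<xi>)"

definition hfun :: "real measure \<Rightarrow> real \<Rightarrow> real" where
  "hfun \<mu> x = (1/2) * (LINT u|distr \<mu> borel eta_of. indicator {0..x} u * exp u)"

definition is_ppp :: "'w measure \<Rightarrow> ('w \<Rightarrow> real measure) \<Rightarrow> (real \<Rightarrow> real) \<Rightarrow> bool" where
  "is_ppp M N h \<longleftrightarrow>
     prob_space M \<and>
     (\<forall>\<omega>\<in>space M. sets (N \<omega>) = sets borel \<and> emeasure (N \<omega>) {..<0} = 0) \<and>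
     (\<forall>B\<in>sets borel. (\<lambda>\<omega>. emeasure (N \<omega>) B) \<in> borel_measurable M) \<and>
     (\<forall>B\<in>sets borel. B \<subseteq> {0..} \<and> bounded B \<longrightarrow>
        (\<forall>k::nat. let r = enn2real (\<integral>\<^sup>+t\<in>B. ennreal (h t) \<partial>lborel) in
           measure M {\<omega>\<in>space M. emeasure (N \<omega>) B = of_nat k} = r ^ k / fact k * exp (- r))) \<and>
     (\<forall>(I::nat set) B. finite I \<and> (\<forall>i\<in>I. B i \<in> sets borel \<and> B i \<subseteq> {0..} \<and> bounded (B i))
        \<and> disjoint_family_on B I \<longrightarrow>
        prob_space.indep_vars M (\<lambda>_. borel) (\<lambda>i \<omega>. emeasure (N \<omega>) (B i)) I)"

definition xlogplus :: "ennreal \<Rightarrow> ennreal" where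
  "xlogplus x = (if x = \<infinity> then \<infinity> else ennreal (enn2real x * max 0 (ln (enn2real x))))"

end

theory Submission imports Defs begin

text \<open>
  The degrees in T(k) add up to 2k - 1, so v_(n+1) attaches to the root with conditional
  probability E[D(K) / (2K - 1)], where D is the root degree and K = max 1 (floor (n (1 - xi))):
  a linear functional of the past of D. With x = 1 - xi, the equation for lambda reads
  E[x powr (lambda - 1)] = 2 lambda, which forces 1/2 \<le> lambda < 1.

  Upper tail: the mean of D satisfies a linear recursion for which n powr lambda is a solution up to
  a relative error O(1/n^2) per step, so E[D(n)] = O(n powr lambda), and Markov's inequality gives
  even a tail of order 1/A.

  Lower tail: linearity yields a backward recursion for E[exp (- s D(n))]. Put
  G_i(j) = E[1{K_i \<ge> j} / (2 K_i - 1)]. If v_j \<le> s + sum_{i>j} (1 - exp (- v_i)) G_(i-1)(j) for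
  all j \<le> n, then E[exp (- s D(n))] \<le> exp (- sum_i (1 - exp (- v_i)) G_(i-1)(1)). For s of order
  y / n powr lambda such a v is y (j powr - lambda - (3 + 2 y) j powr (- 2 lambda)), where the
  second term absorbs both the discretisation error and the quadratic error of 1 - exp (- v).
  This v is of order one at m ~ y powr (1 / lambda), and keeping it constant
  below m makes the last sum at least of order ln m, hence a bound by a negative power of y.
\<close>

subsection \<open>The delayed time\<close>

text \<open>Convexity in a: the power function lies above its tangent at x. With a one or two units
  away from x, this replaces the comparison of sums with integrals below.\<close>

lemma powr_minus_tangent:
  fixes x a s :: real
  assumes "0 < x" "0 < a" "0 \<le> s"
  shows "x powr (-s) + s * (x - a) * x powr (-s-1) \<le> a powr (-s)"
proof -
  have "ln (a / x) \<le> a / x - 1"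
    using assms by (intro ln_le_minus_one) auto
  then have "s * ln (a / x) \<le> s * (a / x - 1)"
    using assms by (intro mult_left_mono) auto
  then have "1 - s * (a / x - 1) \<le> 1 + (- s * ln (a / x))" by simp
  also have "\<dots> \<le> (a / x) powr (-s)"
    using assms exp_ge_add_one_self[of "- s * ln (a / x)"] by (simp add: powr_def)
  finally have "x powr (-s) * (1 - s * (a / x - 1)) \<le> x powr (-s) * (a / x) powr (-s)"
    by (intro mult_left_mono) auto
  also have "\<dots> = a powr (-s)"
    using assms by (simp add: powr_mult[symmetric])
  also have "x powr (-s) * (1 - s * (a / x - 1)) = x powr (-s) + s * (x - a) * x powr (-s-1)"
    using assms by (simp add: powr_diff field_simps)
  finally show ?thesis .
qed

text \<open>The maximum with 1 encodes the convention T(0) = T(1).\<close>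

definition delayed_time :: "nat \<Rightarrow> real \<Rightarrow> nat" where
  "delayed_time n \<xi> = max 1 (nat \<lfloor>real n - real n * \<xi>\<rfloor>)"

lemma delayed_time_measurable [measurable]:
  "delayed_time n \<in> measurable borel (count_space UNIV)"
  unfolding delayed_time_def by measurable

lemma delayed_time_ge_1: "1 \<le> delayed_time n \<xi>"
  by (simp add: delayed_time_def)

lemma delayed_time_le:
  assumes "1 \<le> n" "0 \<le> \<xi>"
  shows "delayed_time n \<xi> \<le> n"
proof -
  have "real n - real n * \<xi> \<le> real n" using assms by simp
  then have "nat \<lfloor>real n - real n * \<xi>\<rfloor> \<le> n" by linarith
  then show ?thesis using assms by (simp add: delayed_time_def)
qed

lemma delayed_time_gt: "real n * (1 - \<xi>) < real (delayed_time n \<xi>) + 1"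
  unfolding delayed_time_def by (simp add: right_diff_distrib) linarith

text \<open>From j = 2 on the maximum with 1 cannot interfere; for j = 1 the left side would always
  hold.\<close>

lemma le_delayed_time_iff:
  assumes "2 \<le> j"
  shows "j \<le> delayed_time n \<xi> \<longleftrightarrow> real j \<le> real n * (1 - \<xi>)"
proof -
  have "j \<le> delayed_time n \<xi> \<longleftrightarrow> int j \<le> \<lfloor>real n - real n * \<xi>\<rfloor>"
    using assms by (auto simp: delayed_time_def le_max_iff_disj)
  then show ?thesis by (simp add: le_floor_iff right_diff_distrib)
qed

lemma delayed_time_le_real:
  assumes "1 \<le> real n * (1 - \<xi>)"
  shows "real (delayed_time n \<xi>) \<le> real n * (1 - \<xi>)"
  using assms unfolding delayed_time_def by (simp add: right_diff_distrib max_def)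

text \<open>Since y = n (1 - xi) is below k + 1 for the delayed time k, and the exponent lam - 1 is
  negative, k^lam is at most (k + 1) y^(lam - 1). The first term on the right is evaluated exactly
  by the equation for lambda; the second is the rounding error.\<close>

lemma delayed_weight_le:
  assumes n: "1 \<le> n" and x: "0 < 1 - \<xi>" and lam: "0 < lam" "lam < 1"
  shows "real (delayed_time n \<xi>) powr lam / (2 * real (delayed_time n \<xi>) - 1)
    \<le> 1 / 2 * (real n * (1 - \<xi>)) powr (lam - 1) + 3 * (real n * (1 - \<xi>)) powr (lam - 2)"
proof -
  define k where "k = real (delayed_time n \<xi>)"
  define y where "y = real n * (1 - \<xi>)"
  have k: "1 \<le> k" "y < k + 1"
    using delayed_time_ge_1[of n \<xi>] delayed_time_gt[of n \<xi>] by (auto simp: k_def y_def)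
  have y: "0 < y" using n x by (simp add: y_def)
  have "k powr lam \<le> (k + 1) powr lam" using k lam by (intro powr_mono2) auto
  also have "\<dots> = (k + 1) * (k + 1) powr (lam - 1)" using k by (simp add: powr_diff)
  also have "\<dots> \<le> (k + 1) * y powr (lam - 1)"
    using k y lam by (intro mult_left_mono powr_mono2') auto
  finally have "k powr lam / (2 * k - 1) \<le> (k + 1) * y powr (lam - 1) / (2 * k - 1)"
    using k by (intro divide_right_mono) auto
  also have "\<dots> = y powr (lam - 1) * ((k + 1) / (2 * k - 1))" by simp
  also have "\<dots> \<le> y powr (lam - 1) * (1 / 2 + 3 / y)"
  proof (intro mult_left_mono)
    \<comment> \<open>The constant 3 is sharp: there is equality at k = 1.\<close>
    have "(k + 1) / (2 * k - 1) \<le> 1 / 2 + 3 / (k + 1)"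
      using k by (simp add: field_simps)
    also have "\<dots> \<le> 1 / 2 + 3 / y" using k y by (intro add_left_mono divide_left_mono) auto
    finally show "(k + 1) / (2 * k - 1) \<le> 1 / 2 + 3 / y" .
  qed auto
  also have "\<dots> = 1 / 2 * y powr (lam - 1) + 3 * y powr (lam - 2)"
    using y by (simp add: powr_diff field_simps power2_eq_square)
  finally show ?thesis by (simp add: k_def y_def)
qed

text \<open>An edge from v_j to the root is present in T(k) exactly for k >= j, and then adds 1 /
  (2k - 1) to the root's share of the total degree.\<close>

definition trunc_weight :: "nat \<Rightarrow> nat \<Rightarrow> real" where
  "trunc_weight j k = (if j \<le> k then 1 / (2 * real k - 1) else 0)"

text \<open>With x = 1 - xi, the weight is nonzero roughly from i = j / x on and is then about 1 /
  (2 x i). Summing i^(-lam - 1) / (2 x) from j / x to n gives the first and the third term; the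
  second pays for rounding.\<close>

lemma delayed_sum_ge:
  assumes xi: "0 < \<xi>" "\<xi> < 1" and lam: "0 < lam" and j: "2 \<le> j" and n: "1 \<le> n"
  shows "real j powr (- lam) / (2 * lam) * (1 - \<xi>) powr (lam - 1) - real j powr (- lam - 1)
      - (real n powr (- lam) / (2 * lam)) * (1 / (1 - \<xi>))
    \<le> (\<Sum>i=Suc j..n. real i powr (- lam) * trunc_weight j (delayed_time (i - 1) \<xi>))"
proof -
  define x where "x = 1 - \<xi>"
  have x: "0 < x" "x < 1" using xi by (auto simp: x_def)
  define z where "z = real j / x"
  have z: "0 < z" "real j \<le> z" using x j by (auto simp: z_def field_simps)
  \<comment> \<open>The delay acts on i - 1, so one more unit is needed: i >= i0 gives i - 1 >=
    z.\<close>
  define i0 where "i0 = Suc (nat \<lceil>z\<rceil>)"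
  have i0: "z + 1 \<le> real i0" "real i0 \<le> z + 2" using z by (auto simp: i0_def) linarith+
  have ji0: "Suc j \<le> i0" using i0 z by linarith
  let ?w = "\<lambda>i. trunc_weight j (delayed_time (i - 1) \<xi>)"
  have w_nonneg: "0 \<le> ?w i" for i
    using delayed_time_ge_1[of "i - 1" \<xi>] by (auto simp: trunc_weight_def)
  have w_ge: "1 / (2 * x * real i) \<le> ?w i" if "i0 \<le> i" for i
  proof -
    have i: "1 \<le> i" "real (i - 1) = real i - 1" using that ji0 j by auto
    have "z \<le> real i - 1" using i0 that by linarith
    then have jx: "real j \<le> real (i - 1) * (1 - \<xi>)" using x i by (simp add: z_def x_def field_simps)
    then have "j \<le> delayed_time (i - 1) \<xi>" using le_delayed_time_iff[OF j] by blast
    moreover have "real (delayed_time (i - 1) \<xi>) \<le> real (i - 1) * (1 - \<xi>)"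
      using jx j by (intro delayed_time_le_real) linarith
    moreover have "real (i - 1) * (1 - \<xi>) \<le> x * real i"
      unfolding i(2) using x by (simp add: x_def algebra_simps)
    ultimately have "2 * real (delayed_time (i - 1) \<xi>) - 1 \<le> 2 * x * real i"
      "1 \<le> 2 * real (delayed_time (i - 1) \<xi>) - 1" "j \<le> delayed_time (i - 1) \<xi>"
      using j by linarith+
    then show ?thesis
      using x i by (auto simp: trunc_weight_def intro!: divide_left_mono mult_pos_pos)
  qed
  have tele: "(real i0 powr (- lam) - real n powr (- lam)) \<le> lam * (\<Sum>i=i0..n. real i powr (- lam - 1))"
  proof (cases "i0 \<le> n")
    case False
    then have "real i0 powr (- lam) \<le> real n powr (- lam)"
      using n lam by (intro powr_mono2') auto
    then show ?thesis using False by simp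
  next
    case True
    then have "real i0 powr (- lam) - real (Suc n) powr (- lam) = (\<Sum>i=i0..n. real i powr (- lam) - real (Suc i) powr (- lam))"
      using sum_Suc_diff'[of i0 "Suc n" "\<lambda>i. - (real i powr (- lam))"]
      by (simp add: atLeastLessThanSuc_atLeastAtMost)
    also have "\<dots> \<le> (\<Sum>i=i0..n. lam * real i powr (- lam - 1))"
    proof (intro sum_mono)
      fix i assume "i \<in> {i0..n}"
      then have "0 < real i" using ji0 by auto
      then show "real i powr (- lam) - real (Suc i) powr (- lam) \<le> lam * real i powr (- lam - 1)"
        using powr_minus_tangent[of "real i" "real (Suc i)" lam] lam by simp
    qed
    finally have "real i0 powr (- lam) - real (Suc n) powr (- lam) \<le> lam * (\<Sum>i=i0..n. real i powr (- lam - 1))"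
      by (simp add: sum_distrib_left)
    moreover have "real (Suc n) powr (- lam) \<le> real n powr (- lam)"
      using True ji0 lam by (intro powr_mono2') auto
    ultimately show ?thesis by linarith
  qed
  \<comment> \<open>Rounding moves the start of the sum by at most two units, since i0 <= z +
    2.\<close>
  have "z powr (- lam) - 2 * lam * z powr (- lam - 1) \<le> (z + 2) powr (- lam)"
    using powr_minus_tangent[of z "z + 2" lam] z lam by (simp add: algebra_simps)
  also have "\<dots> \<le> real i0 powr (- lam)"
    using i0 z lam by (intro powr_mono2') auto
  finally have "z powr (- lam) - 2 * lam * z powr (- lam - 1) - real n powr (- lam)
      \<le> lam * (\<Sum>i=i0..n. real i powr (- lam - 1))" using tele by linarith
  then have "1 / (2 * x * lam) * (z powr (- lam) - 2 * lam * z powr (- lam - 1) - real n powr (- lam))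
      \<le> 1 / (2 * x * lam) * (lam * (\<Sum>i=i0..n. real i powr (- lam - 1)))"
    using x lam by (intro mult_left_mono) auto
  also have "\<dots> = (\<Sum>i=i0..n. real i powr (- lam) * (1 / (2 * x * real i)))"
    using lam by (simp add: powr_diff sum_distrib_left field_simps)
  also have "\<dots> \<le> (\<Sum>i=i0..n. real i powr (- lam) * ?w i)"
    by (intro sum_mono mult_left_mono w_ge) auto
  also have "\<dots> \<le> (\<Sum>i=Suc j..n. real i powr (- lam) * ?w i)"
    using ji0 w_nonneg by (intro sum_mono2) (auto intro!: mult_nonneg_nonneg)
  finally have main: "1 / (2 * x * lam) * (z powr (- lam) - 2 * lam * z powr (- lam - 1) - real n powr (- lam))
    \<le> (\<Sum>i=Suc j..n. real i powr (- lam) * ?w i)" .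
  have "z powr (- lam) = real j powr (- lam) * x powr lam"
    "z powr (- lam - 1) = real j powr (- lam - 1) * (x powr lam * x)"
    using x j by (auto simp: z_def powr_divide powr_minus powr_diff field_simps)
  then have "1 / (2 * x * lam) * (z powr (- lam) - 2 * lam * z powr (- lam - 1) - real n powr (- lam))
    = real j powr (- lam) / (2 * lam) * x powr (lam - 1) - real j powr (- lam - 1) * x powr lam
      - (real n powr (- lam) / (2 * lam)) * (1 / x)"
    using x lam by (simp add: powr_diff field_simps)
  moreover have "real j powr (- lam - 1) * x powr lam \<le> real j powr (- lam - 1) * 1"
    using x lam powr_mono2[of lam x 1] by (intro mult_left_mono) auto
  ultimately show ?thesis using main unfolding x_def[symmetric] by linarith
qed

text \<open>The same comparison from above with exponent s = 2 lam. Since s >= 1, the resulting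
  factor x^(s - 1) / s is at most 1, whatever the delay. What matters later is that 2/3 is below 1:
  a correction of order j^(-2 lam) can then pay for its own effect.\<close>

lemma delayed_sum_le:
  assumes xi: "0 < \<xi>" "\<xi> < 1" and lam: "1 / 2 \<le> lam" and j: "10 \<le> j"
  shows "(\<Sum>i=Suc j..n. real i powr (- (2 * lam)) * trunc_weight j (delayed_time (i - 1) \<xi>)) \<le> 2 / 3 * real j powr (- (2 * lam))"
proof -
  define x where "x = 1 - \<xi>"
  have x: "0 < x" "x < 1" using xi by (auto simp: x_def)
  define z where "z = real j / x"
  have z: "0 < z" "real j \<le> z" using x j by (auto simp: z_def field_simps)
  define s where "s = 2 * lam"
  have s: "1 \<le> s" using lam by (simp add: s_def)
  define i0 where "i0 = Suc (nat \<lceil>z\<rceil>)"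
  have i0: "z + 1 \<le> real i0" "real i0 < z + 2" using z by (auto simp: i0_def) linarith+
  have ji0: "Suc j \<le> i0" using i0 z by linarith
  let ?w = "\<lambda>i. trunc_weight j (delayed_time (i - 1) \<xi>)"
  have w_le: "real i powr (- s) * ?w i \<le> (if i0 \<le> i then 2 / (3 * x) * real i powr (- s - 1) else 0)"
    if i: "Suc j \<le> i" for i
  proof (cases "j \<le> delayed_time (i - 1) \<xi>")
    case True
    have ir: "real (i - 1) = real i - 1" using i by auto
    have jx: "real j \<le> (real i - 1) * x"
      using True j le_delayed_time_iff[of j "i - 1" \<xi>] ir by (simp add: x_def)
    then have "z \<le> real i - 1" using x by (simp add: z_def field_simps)
    then have ii: "i0 \<le> i" using i0 by linarith
    \<comment> \<open>Rounding costs at most 2 x + 3 < 5, and x i >= j >= 10 makes this at most x i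
      / 2.\<close>
    have "3 / 2 * x * real i \<le> 2 * real (delayed_time (i - 1) \<xi>) - 1"
    proof -
      have "(real i - 1) * x < real (delayed_time (i - 1) \<xi>) + 1"
        using delayed_time_gt[of "i - 1" \<xi>] ir by (simp add: x_def)
      moreover have "(real i - 1) * x = x * real i - x" by (simp add: algebra_simps)
      ultimately show ?thesis using jx x j by linarith
    qed
    then have "1 / (2 * real (delayed_time (i - 1) \<xi>) - 1) \<le> 1 / (3 / 2 * x * real i)"
      using x i j True by (intro divide_left_mono) (auto intro!: mult_pos_pos)
    then have "real i powr (- s) * ?w i \<le> real i powr (- s) * (1 / (3 / 2 * x * real i))"
      using True by (intro mult_left_mono) (auto simp: trunc_weight_def)
    also have "\<dots> = 2 / (3 * x) * real i powr (- s - 1)"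
      using i by (simp add: powr_diff field_simps)
    finally show ?thesis using ii by simp
  qed (use x in \<open>auto simp: trunc_weight_def\<close>)
  have tele: "s * (\<Sum>i=i0..n. real i powr (- s - 1)) \<le> z powr (- s)"
  proof (cases "i0 \<le> n")
    case True
    have "s * (\<Sum>i=i0..n. real i powr (- s - 1)) \<le> (\<Sum>i=i0..n. real (i - 1) powr (- s) - real i powr (- s))"
      unfolding sum_distrib_left
    proof (intro sum_mono)
      fix i assume "i \<in> {i0..n}"
      then have "0 < real (i - 1)" "real (i - 1) = real i - 1" using ji0 j by auto
      then show "s * real i powr (- s - 1) \<le> real (i - 1) powr (- s) - real i powr (- s)"
        using powr_minus_tangent[of "real i" "real (i - 1)" s] s by simp
    qed
    also have "\<dots> = real (i0 - 1) powr (- s) - real n powr (- s)"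
      using sum_Suc_diff'[of i0 "Suc n" "\<lambda>i. - (real (i - 1) powr (- s))"] True
      by (simp add: atLeastLessThanSuc_atLeastAtMost)
    also have "\<dots> \<le> real (i0 - 1) powr (- s)" by simp
    also have "\<dots> \<le> z powr (- s)" using i0 z s ji0 by (intro powr_mono2') auto
    finally show ?thesis .
  qed simp
  have "(\<Sum>i=Suc j..n. real i powr (- s) * ?w i)
    \<le> (\<Sum>i=Suc j..n. (if i0 \<le> i then 2 / (3 * x) * real i powr (- s - 1) else 0))"
    by (intro sum_mono w_le) auto
  also have "\<dots> = (\<Sum>i=i0..n. 2 / (3 * x) * real i powr (- s - 1))"
    using ji0 by (intro sum.mono_neutral_cong_right) auto
  also have "\<dots> = 2 / (3 * x * s) * (s * (\<Sum>i=i0..n. real i powr (- s - 1)))"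
    using s by (simp add: sum_distrib_left)
  also have "\<dots> \<le> 2 / (3 * x * s) * z powr (- s)"
    using x s by (intro mult_left_mono tele) auto
  also have "\<dots> = 2 / 3 * real j powr (- s) * (x powr (s - 1) / s)"
    using x s j by (simp add: z_def powr_divide powr_minus powr_diff field_simps)
  also have "\<dots> \<le> 2 / 3 * real j powr (- s) * 1"
  proof (intro mult_left_mono)
    have "x powr (s - 1) \<le> 1" using x s powr_mono2[of "s - 1" x 1] by simp
    then show "x powr (s - 1) / s \<le> 1" using s by simp
  qed auto
  finally show ?thesis by (simp add: s_def)
qed

subsection \<open>The tree process\<close>

lemma tree_lists_1: "tree_lists (Suc 0) = {[]}"
  by (auto simp: tree_lists_def)

lemma tree_lists_Suc:
  assumes "1 \<le> n"
  shows "tree_lists (Suc n) = (\<lambda>(ps, v). ps @ [v]) ` (tree_lists n \<times> {1..n})"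
proof (intro set_eqI iffI)
  fix qs assume qs: "qs \<in> tree_lists (Suc n)"
  then have "qs \<noteq> []" using assms by (auto simp: tree_lists_def)
  then obtain ps v where e: "qs = ps @ [v]" by (metis append_butlast_last_id)
  have l: "length ps = n - 1" using qs e by (auto simp: tree_lists_def)
  have h: "\<And>i. i < length qs \<Longrightarrow> 1 \<le> qs ! i \<and> qs ! i \<le> i + 1"
    using qs by (auto simp: tree_lists_def)
  have "1 \<le> v \<and> v \<le> n"
    using h[of "length ps"] e l assms by (auto simp: nth_append)
  moreover have "ps \<in> tree_lists n"
    unfolding tree_lists_def
  proof (safe)
    show "length ps = n - 1" by fact
    fix i assume "i < length ps"
    then show "1 \<le> ps ! i" "ps ! i \<le> i + 1"
      using h[of i] e by (auto simp: nth_append)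
  qed
  ultimately show "qs \<in> (\<lambda>(ps, v). ps @ [v]) ` (tree_lists n \<times> {1..n})"
    using e by auto
next
  fix qs assume "qs \<in> (\<lambda>(ps, v). ps @ [v]) ` (tree_lists n \<times> {1..n})"
  then show "qs \<in> tree_lists (Suc n)"
    using assms by (auto simp: tree_lists_def nth_append less_Suc_eq)
qed

lemma sum_tree_lists_Suc:
  fixes g :: "nat list \<Rightarrow> real"
  assumes "1 \<le> n"
  shows "(\<Sum>qs\<in>tree_lists (Suc n). g qs) = (\<Sum>ps\<in>tree_lists n. \<Sum>v=1..n. g (ps @ [v]))"
proof -
  have "inj_on (\<lambda>(ps, v). ps @ [v]) (tree_lists n \<times> {1..n})"
    by (auto simp: inj_on_def)
  then show ?thesis
    unfolding tree_lists_Suc[OF assms]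
    by (simp add: sum.reindex sum.cartesian_product case_prod_unfold)
qed

lemma tdeg_append: "k \<le> length ps + 1 \<Longrightarrow> tdeg (ps @ qs) k v = tdeg ps k v"
  by (simp add: tdeg_def)

lemma tdeg_append_last:
  "k = length ps + 2 \<Longrightarrow> tdeg (ps @ [w]) k v = tdeg ps (k - 1) v + (if w = v then 1 else 0)"
  by (simp add: tdeg_def)

text \<open>Each of the k vertices contributes its initial 1, and each of the k - 1 entries of the
  prefix is counted once, at the parent.\<close>

lemma sum_tdeg:
  assumes ps: "ps \<in> tree_lists n" and k: "1 \<le> k" "k \<le> n"
  shows "(\<Sum>u=1..k. real (tdeg ps k u)) = 2 * real k - 1"
proof -
  have len: "length ps = n - 1" and el: "\<And>i. i < length ps \<Longrightarrow> 1 \<le> ps ! i \<and> ps ! i \<le> i + 1"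
    using ps by (auto simp: tree_lists_def)
  have sub: "set (take (k - 1) ps) \<subseteq> {1..k}"
  proof
    fix v assume "v \<in> set (take (k - 1) ps)"
    then obtain i where i: "i < k - 1" "i < length ps" "v = ps ! i"
      by (auto simp: in_set_conv_nth)
    then show "v \<in> {1..k}" using el[of i] by auto
  qed
  have "(\<Sum>u=1..k. count_list (take (k - 1) ps) u) = length (take (k - 1) ps)"
  proof -
    have "(\<Sum>u=1..k. count_list (take (k - 1) ps) u) = (\<Sum>u\<in>set (take (k - 1) ps). count_list (take (k - 1) ps) u)"
      by (rule sum.mono_neutral_right) (use sub in \<open>auto simp: count_list_0_iff\<close>)
    then show ?thesis by (simp add: sum_count_set)
  qed
  also have "\<dots> = k - 1" using len k by simp
  finally have c: "(\<Sum>u=1..k. real (count_list (take (k - 1) ps) u)) = real (k - 1)"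
    by (metis of_nat_sum)
  show ?thesis
    using k c[simplified] by (simp add: tdeg_def sum.distrib of_nat_diff)
qed

text \<open>Mass at the endpoints is excluded, so that negative powers of 1 - xi are meaningful
  almost everywhere; the theorem derives this from the density of eta.\<close>

locale delay_distribution = prob_space \<mu> for \<mu> :: "real measure" +
  assumes sets_\<mu> [measurable_cong]: "sets \<mu> = sets borel"
    and support: "AE \<xi> in \<mu>. 0 < \<xi> \<and> \<xi> < 1"
begin

lemma space_\<mu> [simp]: "space \<mu> = UNIV"
  using sets_eq_imp_space_eq[OF sets_\<mu>] by simp

definition delay_pmf :: "nat \<Rightarrow> nat \<Rightarrow> real" where
  "delay_pmf n k = measure \<mu> {\<xi>. delayed_time n \<xi> = k}"

lemma delay_pmf_nonneg: "0 \<le> delay_pmf n k"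
  by (simp add: delay_pmf_def)

text \<open>Almost surely the delayed time lies in {1..n}, so integrals over the delay become finite
  sums that can be exchanged with the sums over trees.\<close>

lemma integral_delayed_time:
  fixes g :: "nat \<Rightarrow> real"
  assumes "1 \<le> n"
  shows "integrable \<mu> (\<lambda>\<xi>. g (delayed_time n \<xi>))"
    and "(LINT \<xi>|\<mu>. g (delayed_time n \<xi>)) = (\<Sum>k=1..n. delay_pmf n k * g k)"
proof -
  let ?A = "\<lambda>k. {\<xi>. delayed_time n \<xi> = k}"
  let ?s = "\<lambda>\<xi>. \<Sum>k=1..n. indicator (?A k) \<xi> * g k"
  have A: "?A k \<in> sets \<mu>" for k
    by measurable
  have ae: "AE \<xi> in \<mu>. ?s \<xi> = g (delayed_time n \<xi>)"
    using support
  proof eventually_elim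
    case (elim \<xi>)
    have "?s \<xi> = (\<Sum>k=1..n. if k = delayed_time n \<xi> then g k else 0)"
      by (intro sum.cong) (auto simp: indicator_def)
    also have "\<dots> = g (delayed_time n \<xi>)"
      using delayed_time_le[OF assms, of \<xi>] elim delayed_time_ge_1[of n \<xi>] by simp
    finally show ?case .
  qed
  have i: "integrable \<mu> (\<lambda>\<xi>. indicator (?A k) \<xi> * g k)" for k
    using A by (intro integrable_mult_left integrable_real_indicator) (auto simp: emeasure_eq_measure)
  have int_s: "integrable \<mu> ?s"
    by (intro Bochner_Integration.integrable_sum i)
  have m: "(\<lambda>\<xi>. g (delayed_time n \<xi>)) \<in> borel_measurable \<mu>"
    by measurable
  show "integrable \<mu> (\<lambda>\<xi>. g (delayed_time n \<xi>))"
    using integrable_cong_AE_imp[OF int_s m] ae by auto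
  have "(LINT \<xi>|\<mu>. g (delayed_time n \<xi>)) = (LINT \<xi>|\<mu>. ?s \<xi>)"
    using ae m int_s by (intro integral_cong_AE) auto
  also have "\<dots> = (\<Sum>k=1..n. LINT \<xi>|\<mu>. indicator (?A k) \<xi> * g k)"
    by (rule Bochner_Integration.integral_sum) (rule i)
  also have "\<dots> = (\<Sum>k=1..n. delay_pmf n k * g k)"
    by (intro sum.cong refl) (simp add: delay_pmf_def)
  finally show "(LINT \<xi>|\<mu>. g (delayed_time n \<xi>)) = (\<Sum>k=1..n. delay_pmf n k * g k)" .
qed

lemma sum_delay_pmf:
  assumes "1 \<le> n"
  shows "(\<Sum>k=1..n. delay_pmf n k) = 1"
  using integral_delayed_time(2)[OF assms, of "\<lambda>_. 1"] prob_space by simp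

text \<open>The separate clause of \<open>trans_prob\<close> for n = 1 obeys the same formula,
  because the delayed time is then 1 and v_1 has degree 1. The recursions can thus start at n =
  1.\<close>

lemma trans_prob_eq_sum:
  assumes n: "1 \<le> n" and ps: "ps \<in> tree_lists n" and v: "1 \<le> v"
  shows "trans_prob \<mu> n ps v
    = (\<Sum>k=1..n. delay_pmf n k * (if v \<le> k then real (tdeg ps k v) / (2 * real k - 1) else 0))"
proof (cases "n = 1")
  case True
  then show ?thesis
    using v ps sum_delay_pmf[of 1] by (auto simp: trans_prob_def tdeg_def)
next
  case False
  let ?g = "\<lambda>k. if 1 \<le> v \<and> v \<le> k then real (tdeg ps k v) / (\<Sum>u = 1..k. real (tdeg ps k u)) else 0"
  have "trans_prob \<mu> n ps v = (LINT \<xi>|\<mu>. ?g (delayed_time n \<xi>))"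
    using False by (simp add: trans_prob_def delayed_time_def[abs_def] Let_def cong: if_cong)
  also have "\<dots> = (\<Sum>k=1..n. delay_pmf n k * ?g k)"
    by (rule integral_delayed_time(2)[OF n])
  also have "\<dots> = (\<Sum>k=1..n. delay_pmf n k * (if v \<le> k then real (tdeg ps k v) / (2 * real k - 1) else 0))"
    using v by (intro sum.cong refl) (simp add: sum_tdeg[OF ps, simplified])
  finally show ?thesis .
qed

lemma trans_prob_nonneg:
  assumes "1 \<le> n" "ps \<in> tree_lists n" "1 \<le> v"
  shows "0 \<le> trans_prob \<mu> n ps v"
  unfolding trans_prob_eq_sum[OF assms]
  by (intro sum_nonneg mult_nonneg_nonneg delay_pmf_nonneg) auto

lemma sum_trans_prob:
  assumes "1 \<le> n" and ps: "ps \<in> tree_lists n"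
  shows "(\<Sum>v=1..n. trans_prob \<mu> n ps v) = 1"
proof -
  have "(\<Sum>v=1..n. trans_prob \<mu> n ps v)
    = (\<Sum>v=1..n. \<Sum>k=1..n. delay_pmf n k * (if v \<le> k then real (tdeg ps k v) / (2 * real k - 1) else 0))"
    by (intro sum.cong refl trans_prob_eq_sum assms) auto
  also have "\<dots> = (\<Sum>k=1..n. delay_pmf n k * (\<Sum>v=1..n. if v \<le> k then real (tdeg ps k v) / (2 * real k - 1) else 0))"
    by (subst sum.swap) (simp add: sum_distrib_left)
  also have "\<dots> = (\<Sum>k=1..n. delay_pmf n k)"
  proof (intro sum.cong refl)
    fix k assume k: "k \<in> {1..n}"
    have "(\<Sum>v=1..n. if v \<le> k then real (tdeg ps k v) / (2 * real k - 1) else 0)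
      = (\<Sum>v=1..k. real (tdeg ps k v) / (2 * real k - 1))"
      using k by (intro sum.mono_neutral_cong_right) auto
    also have "\<dots> = 1"
      using k sum_tdeg[OF ps, of k] by (simp add: sum_divide_distrib[symmetric])
    finally show "delay_pmf n k * (\<Sum>v=1..n. if v \<le> k then real (tdeg ps k v) / (2 * real k - 1) else 0)
      = delay_pmf n k" by simp
  qed
  finally show ?thesis using sum_delay_pmf[OF assms(1)] by simp
qed

lemma tree_prob_snoc:
  assumes "length ps = n - 1" "1 \<le> n"
  shows "tree_prob \<mu> (ps @ [v]) = tree_prob \<mu> ps * trans_prob \<mu> n ps v"
proof -
  have "(\<Prod>i<length ps. trans_prob \<mu> (i + 1) (take i (ps @ [v])) ((ps @ [v]) ! i)) = tree_prob \<mu> ps"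
    unfolding tree_prob_def by (intro prod.cong) (auto simp: nth_append)
  moreover have "n = Suc (length ps)" using assms by simp
  ultimately show ?thesis
    by (simp add: tree_prob_def[of _ "ps @ [v]"])
qed

definition tree_expectation :: "nat \<Rightarrow> (nat list \<Rightarrow> real) \<Rightarrow> real" where
  "tree_expectation n g = (\<Sum>ps\<in>tree_lists n. tree_prob \<mu> ps * g ps)"

text \<open>Conditional probability that v_(n+1) attaches to the root. It is linear in the past root
  degrees, and both tail bounds rest on this.\<close>

definition root_attach_prob :: "nat \<Rightarrow> nat list \<Rightarrow> real" where
  "root_attach_prob n ps = (\<Sum>k=1..n. delay_pmf n k * (real (tdeg ps k 1) / (2 * real k - 1)))"

lemma tree_prob_nonneg:
  assumes "1 \<le> n" "ps \<in> tree_lists n"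
  shows "0 \<le> tree_prob \<mu> ps"
  using assms
proof (induction n arbitrary: ps rule: nat_induct_at_least)
  case base
  then show ?case by (simp add: tree_lists_1 tree_prob_def)
next
  case (Suc n)
  then obtain qs v where e: "ps = qs @ [v]" "qs \<in> tree_lists n" "v \<in> {1..n}"
    unfolding tree_lists_Suc[OF Suc.hyps] by auto
  then have "length qs = n - 1" by (simp add: tree_lists_def)
  then show ?case
    using Suc e by (simp add: tree_prob_snoc[of _ n] trans_prob_nonneg)
qed

lemma tree_expectation_mono:
  assumes "1 \<le> n" "\<And>ps. ps \<in> tree_lists n \<Longrightarrow> g ps \<le> h ps"
  shows "tree_expectation n g \<le> tree_expectation n h"
  unfolding tree_expectation_def
  using assms by (intro sum_mono mult_left_mono tree_prob_nonneg) auto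

lemma tree_expectation_cmult: "tree_expectation n (\<lambda>ps. c * g ps) = c * tree_expectation n g"
  by (simp add: tree_expectation_def sum_distrib_left mult_ac)

lemma tree_expectation_1: "tree_expectation (Suc 0) g = g []"
  by (simp add: tree_expectation_def tree_lists_1 tree_prob_def)

text \<open>Conditioning on T(n), for functionals that see only whether the new vertex attaches to
  the root: the other choices share the remaining probability.\<close>

lemma tree_expectation_Suc:
  assumes n: "1 \<le> n"
    and g: "\<And>ps v. ps \<in> tree_lists n \<Longrightarrow> v \<in> {1..n} \<Longrightarrow> g (ps @ [v]) = (if v = 1 then a ps else b ps)"
  shows "tree_expectation (Suc n) g
    = tree_expectation n (\<lambda>ps. root_attach_prob n ps * a ps + (1 - root_attach_prob n ps) * b ps)"
proof -
  have "tree_expectation (Suc n) g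
    = (\<Sum>ps\<in>tree_lists n. \<Sum>v=1..n. tree_prob \<mu> (ps @ [v]) * g (ps @ [v]))"
    unfolding tree_expectation_def by (rule sum_tree_lists_Suc[OF n])
  also have "\<dots> = (\<Sum>ps\<in>tree_lists n. tree_prob \<mu> ps *
      (root_attach_prob n ps * a ps + (1 - root_attach_prob n ps) * b ps))"
  proof (intro sum.cong refl)
    fix ps assume ps: "ps \<in> tree_lists n"
    then have len: "length ps = n - 1" by (simp add: tree_lists_def)
    let ?t = "trans_prob \<mu> n ps"
    have t1: "?t 1 = root_attach_prob n ps"
      using trans_prob_eq_sum[OF n ps, of 1] by (auto simp: root_attach_prob_def intro!: sum.cong)
    have "(\<Sum>v=1..n. tree_prob \<mu> (ps @ [v]) * g (ps @ [v]))
      = tree_prob \<mu> ps * (\<Sum>v=1..n. ?t v * (if v = 1 then a ps else b ps))"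
      using g[OF ps] n by (simp add: tree_prob_snoc[OF len] sum_distrib_left mult_ac)
    also have "(\<Sum>v=1..n. ?t v * (if v = 1 then a ps else b ps))
      = (\<Sum>v=1..n. ?t v * b ps + (if v = 1 then ?t v * (a ps - b ps) else 0))"
      by (intro sum.cong) (auto simp: algebra_simps)
    also have "\<dots> = b ps + ?t 1 * (a ps - b ps)"
      using n sum_trans_prob[OF n ps] by (simp add: sum.distrib sum_distrib_right[symmetric])
    finally show "(\<Sum>v=1..n. tree_prob \<mu> (ps @ [v]) * g (ps @ [v])) = tree_prob \<mu> ps *
      (root_attach_prob n ps * a ps + (1 - root_attach_prob n ps) * b ps)"
      by (simp add: t1[simplified] algebra_simps)
  qed
  finally show ?thesis by (simp add: tree_expectation_def)
qed

lemma tree_expectation_const: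
  assumes "1 \<le> n"
  shows "tree_expectation n (\<lambda>_. c) = c"
  using assms
proof (induction n rule: nat_induct_at_least)
  case (Suc n)
  then show ?case
    using tree_expectation_Suc[OF Suc.hyps, of "\<lambda>_. c" "\<lambda>_. c" "\<lambda>_. c"] by (simp add: algebra_simps)
qed (simp add: tree_expectation_1)

text \<open>Markov's inequality in general form: g is linear in the degree for the upper tail and
  exponential for the lower tail.\<close>

lemma tree_event_prob_le:
  assumes "1 \<le> n" "\<And>ps. ps \<in> tree_lists n \<Longrightarrow> 0 \<le> g ps"
    "\<And>ps. ps \<in> tree_lists n \<Longrightarrow> P ps \<Longrightarrow> 1 \<le> g ps"
  shows "tree_event_prob \<mu> n P \<le> tree_expectation n g"
proof -
  have "tree_event_prob \<mu> n P = tree_expectation n (\<lambda>ps. if P ps then 1 else 0)"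
    unfolding tree_event_prob_def tree_expectation_def by (intro sum.cong) auto
  also have "\<dots> \<le> tree_expectation n g"
    using assms by (intro tree_expectation_mono) auto
  finally show ?thesis .
qed

lemma tree_event_prob_le_1: "1 \<le> n \<Longrightarrow> tree_event_prob \<mu> n P \<le> 1"
  using tree_event_prob_le[of n "\<lambda>_. 1" P] by (simp add: tree_expectation_const)

subsection \<open>The mean root degree\<close>

definition mean_root_deg :: "nat \<Rightarrow> real" where
  "mean_root_deg n = tree_expectation n (\<lambda>ps. real (tdeg ps n 1))"

text \<open>Later vertices do not change the prefix T(k), so both branches of the one-step formula
  agree.\<close>

lemma tree_expectation_tdeg:
  assumes "1 \<le> k" "k \<le> n"
  shows "tree_expectation n (\<lambda>ps. real (tdeg ps k 1)) = mean_root_deg k"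
  using assms(2)
proof (induction n rule: dec_induct)
  case base
  then show ?case by (simp add: mean_root_deg_def)
next
  case (step n)
  have "tree_expectation (Suc n) (\<lambda>ps. real (tdeg ps k 1))
    = tree_expectation n (\<lambda>ps. root_attach_prob n ps * real (tdeg ps k 1)
        + (1 - root_attach_prob n ps) * real (tdeg ps k 1))"
    using step assms by (intro tree_expectation_Suc) (auto simp: tdeg_append tree_lists_def)
  also have "\<dots> = tree_expectation n (\<lambda>ps. real (tdeg ps k 1))"
    by (simp add: algebra_simps)
  finally show ?case using step by simp
qed

text \<open>The recursion closes in the means because \<open>root_attach_prob\<close> is linear and
  the mean degree in T(k) is the same under every later tree.\<close>

lemma mean_root_deg_Suc:
  assumes n: "1 \<le> n"
  shows "mean_root_deg (Suc n)
    = mean_root_deg n + (\<Sum>k=1..n. delay_pmf n k * (mean_root_deg k / (2 * real k - 1)))"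
proof -
  have "mean_root_deg (Suc n)
    = tree_expectation n (\<lambda>ps. root_attach_prob n ps * (real (tdeg ps n 1) + 1)
        + (1 - root_attach_prob n ps) * real (tdeg ps n 1))"
    unfolding mean_root_deg_def using n
    by (intro tree_expectation_Suc) (auto simp: tdeg_append_last tree_lists_def)
  also have "\<dots> = tree_expectation n (\<lambda>ps. real (tdeg ps n 1) + root_attach_prob n ps)"
    by (simp add: algebra_simps)
  also have "\<dots> = mean_root_deg n + tree_expectation n (root_attach_prob n)"
    by (simp add: mean_root_deg_def tree_expectation_def sum.distrib algebra_simps)
  also have "tree_expectation n (root_attach_prob n)
    = (\<Sum>k=1..n. delay_pmf n k * (tree_expectation n (\<lambda>ps. real (tdeg ps k 1)) / (2 * real k - 1)))"
    unfolding tree_expectation_def root_attach_prob_def sum_distrib_left sum_divide_distrib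
    by (subst sum.swap) (simp add: mult_ac)
  also have "\<dots> = (\<Sum>k=1..n. delay_pmf n k * (mean_root_deg k / (2 * real k - 1)))"
    by (intro sum.cong refl) (simp add: tree_expectation_tdeg[simplified])
  finally show ?thesis .
qed

subsection \<open>The Laplace transform of the root degree\<close>

text \<open>The quantity G_i(j) of the introduction: the mean of \<open>trunc_weight j\<close> at
  the delayed time of step i.\<close>

definition tail_weight :: "nat \<Rightarrow> nat \<Rightarrow> real" where
  "tail_weight i j = (\<Sum>k=1..i. delay_pmf i k * trunc_weight j k)"

lemma tail_weight_nonneg: "0 \<le> tail_weight i j"
  unfolding tail_weight_def trunc_weight_def
  by (intro sum_nonneg mult_nonneg_nonneg delay_pmf_nonneg) auto

lemma tail_weight_antimono: "j \<le> j' \<Longrightarrow> tail_weight i j' \<le> tail_weight i j"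
  unfolding tail_weight_def trunc_weight_def
  by (intro sum_mono mult_left_mono delay_pmf_nonneg) auto

lemma tail_weight_eq_integral:
  "1 \<le> i \<Longrightarrow> tail_weight i j
    = (LINT \<xi>|\<mu>. trunc_weight j (delayed_time i \<xi>))"
  unfolding tail_weight_def
  using integral_delayed_time(2)[of i "trunc_weight j"] by simp

text \<open>The delayed time never exceeds i. Summed over i, this produces the logarithm in the
  lower tail.\<close>

lemma tail_weight_1_ge:
  assumes "1 \<le> i"
  shows "1 / (2 * real i) \<le> tail_weight i 1"
proof -
  have "1 / (2 * real i) = (\<Sum>k=1..i. delay_pmf i k * (1 / (2 * real i)))"
    using sum_delay_pmf[OF assms] by (simp add: sum_divide_distrib[symmetric])
  also have "\<dots> \<le> tail_weight i 1"
    unfolding tail_weight_def trunc_weight_def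
    by (intro sum_mono mult_left_mono delay_pmf_nonneg) (auto intro!: divide_left_mono)
  finally show ?thesis .
qed

lemma root_attach_prob_nonneg: "0 \<le> root_attach_prob n ps"
  unfolding root_attach_prob_def by (intro sum_nonneg mult_nonneg_nonneg delay_pmf_nonneg) auto

text \<open>The hypothesis makes v a subsolution: v j is at most the weight which an edge from v_j
  to the root receives in the exponent. Averaging over the vertices backwards from v_n keeps the
  exponent linear in the past degrees, and only an inequality is needed at each step.\<close>

lemma laplace_root_deg_le:
  fixes v :: "nat \<Rightarrow> real"
  assumes n: "1 \<le> n"
    and v_le: "\<And>j. 1 \<le> j \<Longrightarrow> j \<le> n \<Longrightarrow> v j \<le> s + (\<Sum>i=Suc j..n. (1 - exp (- v i)) * tail_weight (i - 1) j)"
  shows "tree_expectation n (\<lambda>ps. exp (- s * real (tdeg ps n 1)))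
    \<le> exp (- s - (\<Sum>i=2..n. (1 - exp (- v i)) * tail_weight (i - 1) 1))"
proof -
  \<comment> \<open>\<open>R j i\<close> is the attachment probability at time i as seen from time
    j: degrees in later trees are frozen at their value in T(j).\<close>
  define R where "R j i ps = (\<Sum>k=1..i. delay_pmf i k * (real (tdeg ps (min k j) 1) / (2 * real k - 1)))"
    for j i and ps :: "nat list"
  define L where "L j ps = s * real (tdeg ps j 1) + (\<Sum>i=Suc j..n. (1 - exp (- v i)) * R j (i - 1) ps)"
    for j ps
  \<comment> \<open>L j is the exponent left after averaging over the attachments of v_(j+1), ..., v_n.\<close>
  have level_step: "tree_expectation (Suc j) (\<lambda>ps. exp (- L (Suc j) ps)) \<le> tree_expectation j (\<lambda>ps. exp (- L j ps))"
    if j: "1 \<le> j" "j < n" for j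
  proof -
    \<comment> \<open>\<open>?B\<close> is the exponent if v_(j+1) attaches elsewhere, and
      \<open>?c\<close> is what an edge to the root adds to it.\<close>
    let ?B = "\<lambda>ps. s * real (tdeg ps j 1) + (\<Sum>i=Suc (Suc j)..n. (1 - exp (- v i)) * R j (i - 1) ps)"
    let ?c = "s + (\<Sum>i=Suc (Suc j)..n. (1 - exp (- v i)) * tail_weight (i - 1) (Suc j))"
    have R_snoc: "R (Suc j) i (ps @ [w]) = R j i ps + (if w = 1 then tail_weight i (Suc j) else 0)"
      if ps: "ps \<in> tree_lists j" for i ps w
    proof -
      have len: "length ps + 2 = Suc j" using ps j by (simp add: tree_lists_def)
      have "tdeg (ps @ [w]) (min k (Suc j)) 1
        = tdeg ps (min k j) 1 + (if w = 1 \<and> Suc j \<le> k then 1 else 0)" for k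
      proof (cases "Suc j \<le> k")
        case True
        then have "min k (Suc j) = length ps + 2" "min k j = length ps + 1" using len by auto
        then show ?thesis using True by (simp add: tdeg_append_last)
      next
        case False
        then show ?thesis using len by (simp add: tdeg_append min_def)
      qed
      then have "delay_pmf i k * (real (tdeg (ps @ [w]) (min k (Suc j)) 1) / (2 * real k - 1))
        = delay_pmf i k * (real (tdeg ps (min k j) 1) / (2 * real k - 1))
          + (if w = 1 then delay_pmf i k * trunc_weight (Suc j) k else 0)" for k
        by (simp add: trunc_weight_def add_divide_distrib ring_distribs)
      then show ?thesis
        by (simp add: R_def tail_weight_def sum.distrib)
    qed
    have L_snoc: "L (Suc j) (ps @ [w]) = (if w = 1 then ?B ps + ?c else ?B ps)"
      if ps: "ps \<in> tree_lists j" for ps w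
    proof -
      have "length ps + 2 = Suc j" using ps j by (simp add: tree_lists_def)
      then have "tdeg (ps @ [w]) (Suc j) 1 = tdeg ps j 1 + (if w = 1 then 1 else 0)"
        by (simp add: tdeg_append_last)
      then show ?thesis
        by (simp add: L_def R_snoc[OF ps] sum.distrib distrib_left)
    qed
    have L_eq: "L j ps = ?B ps + (1 - exp (- v (Suc j))) * root_attach_prob j ps" for ps
    proof -
      have "R j j ps = root_attach_prob j ps"
        unfolding R_def root_attach_prob_def by (intro sum.cong) auto
      then show ?thesis
        using j by (simp add: L_def sum.atLeast_Suc_atMost)
    qed
    have "tree_expectation (Suc j) (\<lambda>ps. exp (- L (Suc j) ps))
      = tree_expectation j (\<lambda>ps. root_attach_prob j ps * exp (- (?B ps + ?c))
          + (1 - root_attach_prob j ps) * exp (- ?B ps))"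
      using j by (intro tree_expectation_Suc) (auto simp: L_snoc simp del: minus_add_distrib)
    also have "\<dots> \<le> tree_expectation j (\<lambda>ps. exp (- L j ps))"
    proof (intro tree_expectation_mono)
      fix ps
      let ?q = "root_attach_prob j ps"
      \<comment> \<open>The subsolution property enters here. Then 1 + u <= e^u turns the mixture of
        the two branches into the exponential of a multiple of q, which is linear in the
        past.\<close>
      have "exp (- ?c) \<le> exp (- v (Suc j))"
        using v_le[of "Suc j"] j by simp
      then have "?q * exp (- ?c) \<le> ?q * exp (- v (Suc j))"
        by (intro mult_left_mono root_attach_prob_nonneg)
      then have "?q * exp (- ?c) + (1 - ?q) \<le> 1 + - ((1 - exp (- v (Suc j))) * ?q)"
        by (simp add: algebra_simps)
      also have "\<dots> \<le> exp (- ((1 - exp (- v (Suc j))) * ?q))"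
        by (rule exp_ge_add_one_self)
      finally have "exp (- ?B ps) * (?q * exp (- ?c) + (1 - ?q))
        \<le> exp (- ?B ps) * exp (- ((1 - exp (- v (Suc j))) * ?q))"
        by (intro mult_left_mono) auto
      moreover have "exp (- (?B ps + ?c)) = exp (- ?B ps) * exp (- ?c)"
        "exp (- L j ps) = exp (- ?B ps) * exp (- ((1 - exp (- v (Suc j))) * ?q))"
        unfolding L_eq minus_add_distrib exp_add by (rule refl)+
      ultimately show "?q * exp (- (?B ps + ?c)) + (1 - ?q) * exp (- ?B ps) \<le> exp (- L j ps)"
        by (simp only: ring_distribs mult_ac)
    qed (use j in auto)
    finally show ?thesis .
  qed
  have "tree_expectation n (\<lambda>ps. exp (- L n ps)) \<le> tree_expectation j (\<lambda>ps. exp (- L j ps))"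
    if "j \<le> n" "1 \<le> j" for j
    using that
  proof (induction j rule: inc_induct)
    case (step j)
    then show ?case using level_step[of j] by simp
  qed simp
  from this[OF n] have "tree_expectation n (\<lambda>ps. exp (- L n ps)) \<le> tree_expectation 1 (\<lambda>ps. exp (- L 1 ps))"
    by simp
  moreover have "L n = (\<lambda>ps. s * real (tdeg ps n 1))"
    by (auto simp: L_def)
  moreover have "L 1 [] = s + (\<Sum>i=2..n. (1 - exp (- v i)) * tail_weight (i - 1) 1)"
  proof -
    have "R 1 i [] = tail_weight i 1" for i
      unfolding R_def tail_weight_def trunc_weight_def by (intro sum.cong) (auto simp: tdeg_def)
    then show ?thesis by (simp add: L_def tdeg_def numeral_2_eq_2)
  qed
  ultimately show ?thesis by (simp add: tree_expectation_1)
qed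

text \<open>By the equation for lambda, the recursion applied to k^lam yields the increment lam
  n^(lam - 1) up to O(n^(lam - 2)), the increment of n^lam itself. The relative errors are O(1/n^2),
  so their product stays bounded.\<close>

lemma mean_root_deg_bound:
  assumes lam: "0 < lam" "lam < 1"
    and int1: "integrable \<mu> (\<lambda>\<xi>. (1 - \<xi>) powr (lam - 1))"
    and eq1: "(LINT \<xi>|\<mu>. (1 - \<xi>) powr (lam - 1)) = 2 * lam"
    and int2: "integrable \<mu> (\<lambda>\<xi>. (1 - \<xi>) powr (lam - 2))"
  shows "\<exists>C>0. \<forall>n\<ge>1. mean_root_deg n \<le> C * real n powr lam"
proof -
  define I where "I = (LINT \<xi>|\<mu>. (1 - \<xi>) powr (lam - 2))"
  \<comment> \<open>3 I is the rounding error from \<open>delayed_weight_le\<close>; the 1 pays for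
    t - t^2 <= ln (1 + t), multiplied by lam < 1.\<close>
  define c where "c = 3 * I + 1"
  have I: "0 \<le> I" unfolding I_def by (intro integral_nonneg_AE) auto
  have sum_le: "(\<Sum>k=1..n. delay_pmf n k * (real k powr lam / (2 * real k - 1)))
      \<le> lam * real n powr (lam - 1) + 3 * I * real n powr (lam - 2)"
    if n: "1 \<le> n" for n
  proof -
    let ?h = "\<lambda>\<xi>. (1 / 2 * real n powr (lam - 1)) * (1 - \<xi>) powr (lam - 1)
        + (3 * real n powr (lam - 2)) * (1 - \<xi>) powr (lam - 2)"
    have "(\<Sum>k=1..n. delay_pmf n k * (real k powr lam / (2 * real k - 1)))
      = (LINT \<xi>|\<mu>. real (delayed_time n \<xi>) powr lam / (2 * real (delayed_time n \<xi>) - 1))"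
      using integral_delayed_time(2)[OF n, of "\<lambda>k. real k powr lam / (2 * real k - 1)"] by simp
    also have "\<dots> \<le> (LINT \<xi>|\<mu>. ?h \<xi>)"
    proof (rule integral_mono_AE)
      show "integrable \<mu> (\<lambda>\<xi>. real (delayed_time n \<xi>) powr lam / (2 * real (delayed_time n \<xi>) - 1))"
        using integral_delayed_time(1)[OF n, of "\<lambda>k. real k powr lam / (2 * real k - 1)"] by simp
      show "integrable \<mu> ?h" using int1 int2 by simp
      show "AE \<xi> in \<mu>. real (delayed_time n \<xi>) powr lam / (2 * real (delayed_time n \<xi>) - 1) \<le> ?h \<xi>"
        using support
      proof eventually_elim
        case (elim \<xi>)
        then have "0 < 1 - \<xi>" by simp
        from delayed_weight_le[OF n this lam] show ?case
          using n elim by (simp add: powr_mult mult_ac)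
      qed
    qed
    also have "\<dots> = lam * real n powr (lam - 1) + 3 * I * real n powr (lam - 2)"
      using int1 int2 eq1 by (simp add: I_def)
    finally show ?thesis .
  qed
  define S where "S n = (\<Sum>k=1..<n. 1 / real k ^ 2)" for n :: nat
  have S_mono: "S k \<le> S n" if "k \<le> n" for k n
    unfolding S_def using that by (intro sum_mono2) auto
  have bound: "mean_root_deg n \<le> real n powr lam * exp (c * S n)" if "1 \<le> n" for n
    using that
  proof (induction n rule: less_induct)
    case (less n)
    show ?case
    proof (cases "n = 1")
      case True
      then show ?thesis by (simp add: mean_root_deg_def tree_expectation_1 tdeg_def S_def)
    next
      case False
      define m where "m = n - 1"
      have m: "1 \<le> m" "n = Suc m" using False less.prems by (auto simp: m_def)
      let ?t = "1 / real m"
      \<comment> \<open>Weakened from \<open>S k\<close> to \<open>S m\<close>, so that one common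
        factor leaves the recursion.\<close>
      have IH: "mean_root_deg k \<le> real k powr lam * exp (c * S m)" if "1 \<le> k" "k \<le> m" for k
      proof -
        have "mean_root_deg k \<le> real k powr lam * exp (c * S k)" using less.IH[of k] that m by simp
        also have "\<dots> \<le> real k powr lam * exp (c * S m)"
          using S_mono[OF that(2)] I by (intro mult_left_mono) (auto simp: c_def intro!: mult_left_mono)
        finally show ?thesis .
      qed
      have "mean_root_deg n = mean_root_deg m + (\<Sum>k=1..m. delay_pmf m k * (mean_root_deg k / (2 * real k - 1)))"
        using mean_root_deg_Suc[OF m(1)] m(2) by simp
      also have "\<dots> \<le> real m powr lam * exp (c * S m)
          + (\<Sum>k=1..m. delay_pmf m k * (real k powr lam * exp (c * S m) / (2 * real k - 1)))"
        using m by (intro add_mono IH sum_mono mult_left_mono delay_pmf_nonneg divide_right_mono) auto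
      also have "\<dots> = exp (c * S m) * (real m powr lam
          + (\<Sum>k=1..m. delay_pmf m k * (real k powr lam / (2 * real k - 1))))"
        by (simp add: sum_distrib_left ring_distribs mult_ac)
      also have "\<dots> \<le> exp (c * S m) * (real m powr lam
          + (lam * real m powr (lam - 1) + 3 * I * real m powr (lam - 2)))"
        by (intro mult_left_mono add_left_mono sum_le m) auto
      also have "real m powr lam + (lam * real m powr (lam - 1) + 3 * I * real m powr (lam - 2))
          = real m powr lam * (1 + (lam * ?t + 3 * I * ?t ^ 2))"
        using m by (simp add: powr_diff field_simps power2_eq_square)
      also have "\<dots> \<le> real m powr lam * exp (lam * ?t + 3 * I * ?t ^ 2)"
        by (intro mult_left_mono exp_ge_add_one_self) auto
      also have "\<dots> \<le> real m powr lam * exp (lam * ln (1 + ?t) + c * ?t ^ 2)"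
      proof -
        have "?t - ?t ^ 2 \<le> ln (1 + ?t)"
          using m by (intro ln_one_plus_pos_lower_bound) auto
        then have "lam * (?t - ?t ^ 2) \<le> lam * ln (1 + ?t)"
          using lam by (intro mult_left_mono) auto
        moreover have "lam * ?t ^ 2 \<le> 1 * ?t ^ 2"
          using lam by (intro mult_right_mono) auto
        ultimately have "lam * ?t + 3 * I * ?t ^ 2 \<le> lam * ln (1 + ?t) + c * ?t ^ 2"
          unfolding c_def right_diff_distrib distrib_right by linarith
        then show ?thesis by (intro mult_left_mono) auto
      qed
      also have "real m powr lam * exp (lam * ln (1 + ?t) + c * ?t ^ 2) = real n powr lam * exp (c * ?t ^ 2)"
      proof -
        have "0 < 1 + ?t" by (intro add_pos_nonneg) auto
        then have "exp (lam * ln (1 + ?t)) = (1 + ?t) powr lam"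
          by (simp add: powr_def)
        moreover have "real m powr lam * (1 + ?t) powr lam = real n powr lam"
          using m by (simp add: powr_mult[symmetric] distrib_left add.commute)
        ultimately show ?thesis by (simp add: exp_add)
      qed
      finally have "mean_root_deg n \<le> exp (c * S m) * (real n powr lam * exp (c * ?t ^ 2))"
        by (simp add: mult_left_mono)
      also have "\<dots> = real n powr lam * exp (c * S n)"
        using m by (simp add: S_def exp_add[symmetric] ring_distribs power_divide)
      finally show ?thesis .
    qed
  qed
  \<comment> \<open>The term k = 0 is 1 / 0 = 0 by convention.\<close>
  define Z where "Z = (\<Sum>k. 1 / real k ^ 2)"
  have "S n \<le> Z" for n
  proof -
    have "summable (\<lambda>k. 1 / real k ^ 2)"
      using inverse_power_summable[of 2, where 'a=real] by (simp add: divide_inverse)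
    then show ?thesis
      unfolding S_def Z_def by (intro sum_le_suminf) auto
  qed
  then have "mean_root_deg n \<le> exp (c * Z) * real n powr lam" if "1 \<le> n" for n
    using bound[OF that] I
    by (intro order_trans[OF bound[OF that]]) (auto simp: c_def mult.commute intro!: mult_left_mono)
  then show ?thesis by (intro exI[of _ "exp (c * Z)"]) auto
qed

section \<open>Averaging the truncated sums over the delay\<close>

lemma sum_tail_weight_eq_integral:
  assumes "1 \<le> j"
  shows "integrable \<mu> (\<lambda>\<xi>. \<Sum>i=Suc j..n. y i * trunc_weight j (delayed_time (i - 1) \<xi>))"
    and "(\<Sum>i=Suc j..n. y i * tail_weight (i - 1) j)
      = (LINT \<xi>|\<mu>. (\<Sum>i=Suc j..n. y i * trunc_weight j (delayed_time (i - 1) \<xi>)))"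
proof -
  have int: "integrable \<mu> (\<lambda>\<xi>. y i * trunc_weight j (delayed_time (i - 1) \<xi>))" if "i \<in> {Suc j..n}" for i
    using integral_delayed_time(1)[of "i - 1" "\<lambda>k. y i * trunc_weight j k"]
      that assms by auto
  then show "integrable \<mu> (\<lambda>\<xi>. \<Sum>i=Suc j..n. y i * trunc_weight j (delayed_time (i - 1) \<xi>))"
    by (intro Bochner_Integration.integrable_sum)
  show "(\<Sum>i=Suc j..n. y i * tail_weight (i - 1) j)
      = (LINT \<xi>|\<mu>. (\<Sum>i=Suc j..n. y i * trunc_weight j (delayed_time (i - 1) \<xi>)))"
    using assms
    by (subst Bochner_Integration.integral_sum[OF int])
      (auto intro!: sum.cong simp: tail_weight_eq_integral[simplified])
qed

text \<open>After averaging, the equation for lambda turns the coefficient of j^(-lam) into exactly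
  1, so j^(-lam) solves the linearised backward recursion up to rounding and the cut-off at
  n.\<close>

lemma sum_tail_weight_ge:
  assumes lam: "0 < lam" and j: "2 \<le> j" and n: "1 \<le> n"
    and int1: "integrable \<mu> (\<lambda>\<xi>. (1 - \<xi>) powr (lam - 1))"
    and eq1: "(LINT \<xi>|\<mu>. (1 - \<xi>) powr (lam - 1)) = 2 * lam"
    and int2: "integrable \<mu> (\<lambda>\<xi>. 1 / (1 - \<xi>))"
  shows "real j powr (- lam) - real j powr (- lam - 1)
      - (LINT \<xi>|\<mu>. 1 / (1 - \<xi>)) / (2 * lam) * real n powr (- lam)
    \<le> (\<Sum>i=Suc j..n. real i powr (- lam) * tail_weight (i - 1) j)"
proof -
  let ?h = "\<lambda>\<xi>. real j powr (- lam) / (2 * lam) * (1 - \<xi>) powr (lam - 1) - real j powr (- lam - 1)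
      - (real n powr (- lam) / (2 * lam)) * (1 / (1 - \<xi>))"
  have "real j powr (- lam) - real j powr (- lam - 1)
      - (LINT \<xi>|\<mu>. 1 / (1 - \<xi>)) / (2 * lam) * real n powr (- lam) = (LINT \<xi>|\<mu>. ?h \<xi>)"
  proof -
    have "(LINT \<xi>|\<mu>. ?h \<xi>) = real j powr (- lam) / (2 * lam) * (LINT \<xi>|\<mu>. (1 - \<xi>) powr (lam - 1))
        - real j powr (- lam - 1) - (real n powr (- lam) / (2 * lam)) * (LINT \<xi>|\<mu>. 1 / (1 - \<xi>))"
      using prob_space
      by (subst Bochner_Integration.integral_diff Bochner_Integration.integral_mult_right_zero;
          (intro integrable_mult_right int1 int2 Bochner_Integration.integrable_diff integrable_const)?)+
         simp
    then show ?thesis using eq1 lam by simp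
  qed
  also have "\<dots> \<le> (\<Sum>i=Suc j..n. real i powr (- lam) * tail_weight (i - 1) j)"
    unfolding sum_tail_weight_eq_integral(2)[OF order_trans[OF one_le_numeral j]]
  proof (rule integral_mono_AE)
    show "integrable \<mu> ?h"
      by (intro integrable_mult_right int1 int2 Bochner_Integration.integrable_diff integrable_const)
    show "AE \<xi> in \<mu>. ?h \<xi> \<le> (\<Sum>i=Suc j..n. real i powr (- lam) * trunc_weight j (delayed_time (i - 1) \<xi>))"
      using support
    proof eventually_elim
      case (elim \<xi>)
      then show ?case using delayed_sum_ge[of \<xi> lam j n] lam j n by simp
    qed
  qed (use j in \<open>intro sum_tail_weight_eq_integral(1), simp\<close>)
  finally show ?thesis .
qed

lemma sum_tail_weight_le:
  assumes lam: "1 / 2 \<le> lam" and j: "10 \<le> j"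
  shows "(\<Sum>i=Suc j..n. real i powr (- (2 * lam)) * tail_weight (i - 1) j)
    \<le> 2 / 3 * real j powr (- (2 * lam))"
proof -
  have "(\<Sum>i=Suc j..n. real i powr (- (2 * lam)) * tail_weight (i - 1) j)
    \<le> (LINT \<xi>|\<mu>. 2 / 3 * real j powr (- (2 * lam)))"
    unfolding sum_tail_weight_eq_integral(2)[OF order_trans[OF one_le_numeral j]]
  proof (rule integral_mono_AE)
    show "AE \<xi> in \<mu>. (\<Sum>i=Suc j..n. real i powr (- (2 * lam)) * trunc_weight j (delayed_time (i - 1) \<xi>)) \<le> 2 / 3 * real j powr (- (2 * lam))"
      using support
    proof eventually_elim
      case (elim \<xi>)
      then show ?case using delayed_sum_le[of \<xi> lam j n] lam j by simp
    qed
  qed (use j in \<open>(intro sum_tail_weight_eq_integral(1) integrable_const, simp?)+\<close>)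
  then show ?thesis using prob_space by simp
qed

subsection \<open>Tail bounds\<close>

lemma root_deg_tree_lists: "ps \<in> tree_lists n \<Longrightarrow> 1 \<le> n \<Longrightarrow> root_deg ps = tdeg ps n 1"
  by (simp add: root_deg_def tree_lists_def)

text \<open>Markov's inequality gives C / A, which for A >= 1 is stronger than the claimed power.
  For A < 1 the bound exceeds 1, thanks to the summand 1 in C + 1.\<close>

lemma root_deg_upper_tail:
  assumes C: "0 < C" "\<And>n. 1 \<le> n \<Longrightarrow> mean_root_deg n \<le> C * real n powr lam"
    and lam: "0 < lam" and A: "0 < A"
  shows "limsup (\<lambda>n. ereal (tree_event_prob \<mu> n (\<lambda>ps. real (root_deg ps) > A * real n powr lam)))
    \<le> ereal ((C + 1) / A powr (1 / (lam + 1)))"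
proof (intro Limsup_bounded eventually_sequentiallyI[of 1])
  fix n :: nat assume n: "1 \<le> n"
  let ?P = "tree_event_prob \<mu> n (\<lambda>ps. real (root_deg ps) > A * real n powr lam)"
  have p: "0 \<le> 1 / (lam + 1)" "1 / (lam + 1) \<le> 1" using lam by auto
  have "?P \<le> (C + 1) / A powr (1 / (lam + 1))"
  proof (cases "1 \<le> A")
    case True
    have pos: "0 < A * real n powr lam" using A n by simp
    have "?P \<le> tree_expectation n (\<lambda>ps. 1 / (A * real n powr lam) * real (tdeg ps n 1))"
      using n pos by (intro tree_event_prob_le) (auto simp: root_deg_tree_lists field_simps)
    also have "\<dots> = mean_root_deg n / (A * real n powr lam)"
      by (simp only: tree_expectation_cmult mean_root_deg_def) simp
    also have "\<dots> \<le> C * real n powr lam / (A * real n powr lam)"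
      using C(2)[OF n] pos by (intro divide_right_mono) auto
    also have "\<dots> = C / A" using n by simp
    also have "\<dots> \<le> (C + 1) / A powr (1 / (lam + 1))"
      using powr_mono[OF p(2) True] A C by (intro frac_le) auto
    finally show ?thesis .
  next
    case False
    then have "A powr (1 / (lam + 1)) \<le> 1" using powr_mono2[of "1 / (lam + 1)" A 1] A p by simp
    then have "1 \<le> (C + 1) / A powr (1 / (lam + 1))" using A C by (simp add: le_divide_eq)
    then show ?thesis using tree_event_prob_le_1[OF n] by (rule order_trans[rotated])
  qed
  then show "ereal ?P \<le> ereal ((C + 1) / A powr (1 / (lam + 1)))" by simp
qed

text \<open>Constructs the subsolution for \<open>laplace_root_deg_le\<close>. It is of order one up
  to an index m of order y^(1 / lam), and the harmonic sum up to m gives the negative power of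
  y.\<close>

lemma laplace_root_deg_power_bound:
  assumes lam: "1 / 2 \<le> lam" "lam < 1" and y: "1 \<le> y"
    and int1: "integrable \<mu> (\<lambda>\<xi>. (1 - \<xi>) powr (lam - 1))"
    and eq1: "(LINT \<xi>|\<mu>. (1 - \<xi>) powr (lam - 1)) = 2 * lam"
    and int2: "integrable \<mu> (\<lambda>\<xi>. 1 / (1 - \<xi>))"
    and H_def: "H = (LINT \<xi>|\<mu>. 1 / (1 - \<xi>)) / (2 * lam)" and H: "0 < H"
    and n: "nat \<lceil>(4 * (3 + 2 * y)) powr (1 / lam)\<rceil> \<le> n"
  shows "tree_expectation n (\<lambda>ps. exp (- (y * H * real n powr (- lam)) * real (tdeg ps n 1)))
    \<le> y powr (- ((1 - exp (- 1 / 64)) / 2 / lam))"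
proof -
  \<comment> \<open>B solves B = 1 + (2/3) (B + y): 1 for the rounding error, B + y for the
    corrections to 1 - exp (- w), reduced by the factor 2/3 of
    \<open>sum_tail_weight_le\<close>.\<close>
  define B where "B = 3 + 2 * y"
  define b where "b = 4 * B"
  \<comment> \<open>From m on, B j^(-lam) <= 1/4, so w stays between 3/4 and 1 times y
    j^(-lam).\<close>
  define m where "m = nat \<lceil>b powr (1 / lam)\<rceil>"
  define s where "s = y * H * real n powr (- lam)"
  have l0: "0 < lam" using lam by simp
  have b: "20 \<le> b" "b \<le> 20 * y" using y by (auto simp: b_def B_def)
  have "b powr 1 \<le> b powr (1 / lam)" using b lam by (intro powr_mono) auto
  then have bb: "20 \<le> b powr (1 / lam)" using b by simp
  have m: "b powr (1 / lam) \<le> real m" "real m \<le> 2 * b powr (1 / lam)"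
    using bb unfolding m_def by linarith+
  have m10: "10 \<le> m" using m bb by linarith
  have mn: "m \<le> n" using n by (simp add: m_def b_def B_def)
  have m_lower: "b \<le> real m powr lam"
    using powr_mono2[OF _ _ m(1), of lam] l0 b by (simp add: powr_powr)
  have m_upper: "real m powr lam \<le> 2 * b"
  proof -
    have "real m powr lam \<le> (2 * b powr (1 / lam)) powr lam"
      using m l0 by (intro powr_mono2) auto
    also have "\<dots> = 2 powr lam * b" using l0 b by (simp add: powr_mult powr_powr)
    also have "\<dots> \<le> 2 powr 1 * b" using lam b by (intro mult_right_mono powr_mono) auto
    finally show ?thesis by simp
  qed
  define w where "w j = y * (real j powr (- lam) - B * real j powr (- (2 * lam)))" for j :: nat
  \<comment> \<open>Below m the formula for w loses its meaning as a small correction, so it is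
    frozen there.\<close>
  define v where "v j = w (max j m)" for j
  have w_bounds: "3 / 4 * (y * real j powr (- lam)) \<le> w j" "w j \<le> y * real j powr (- lam)" if j: "m \<le> j" for j
  proof -
    have "b \<le> real j powr lam"
      using m_lower powr_mono2[of lam "real m" "real j"] j l0 by simp
    moreover from this have "0 < real j powr lam" using b by linarith
    ultimately have "B * real j powr (- lam) \<le> 1 / 4"
      by (simp add: powr_minus field_simps b_def)
    then have "(B * real j powr (- lam)) * real j powr (- lam) \<le> 1 / 4 * real j powr (- lam)"
      by (intro mult_right_mono) auto
    moreover have "real j powr (- (2 * lam)) = real j powr (- lam) * real j powr (- lam)"
      by (simp add: powr_add[symmetric])
    ultimately have "3 / 4 * real j powr (- lam) \<le> real j powr (- lam) - B * real j powr (- (2 * lam))"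
      by (simp add: mult_ac)
    then have "y * (3 / 4 * real j powr (- lam)) \<le> w j"
      unfolding w_def using y by (intro mult_left_mono) auto
    then show "3 / 4 * (y * real j powr (- lam)) \<le> w j" by simp
    show "w j \<le> y * real j powr (- lam)"
      unfolding w_def using y by (intro mult_left_mono) (auto simp: B_def)
  qed
  have w_nonneg: "0 \<le> w j" if "m \<le> j" for j
    using w_bounds(1)[OF that] y by (intro order_trans[OF _ w_bounds(1)[OF that]]) auto
  have v_nonneg: "0 \<le> v j" for j
    by (simp add: v_def w_nonneg)
  \<comment> \<open>Since m^lam <= 2 b <= 40 y, the value w m is at least (3/4) (1/40), which
    exceeds 1/64.\<close>
  have v_ge: "1 / 64 \<le> v j" if "j \<le> m" for j
  proof -
    have "real m powr lam \<le> 40 * y" using m_upper b by linarith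
    then have "1 / 40 \<le> y * real m powr (- lam)"
      using m10 by (simp add: powr_minus field_simps)
    then show ?thesis using w_bounds(1)[of m] that by (simp add: v_def max_absorb2)
  qed
  have w_sub: "w j \<le> s + (\<Sum>i=Suc j..n. (1 - exp (- v i)) * tail_weight (i - 1) j)"
    if j: "m \<le> j" "j \<le> n" for j
  proof -
    let ?G = "\<lambda>i. tail_weight (i - 1) j"
    let ?S1 = "\<Sum>i=Suc j..n. real i powr (- lam) * ?G i"
    let ?S2 = "\<Sum>i=Suc j..n. real i powr (- (2 * lam)) * ?G i"
    \<comment> \<open>Uses 1 - exp (- w) >= w - w^2; both the correction in w and the square are of
      order i^(-2 lam).\<close>
    have phi: "y * real i powr (- lam) - (y * B + y ^ 2) * real i powr (- (2 * lam)) \<le> 1 - exp (- v i)"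
      if "Suc j \<le> i" for i
    proof -
      have i: "m \<le> i" using that j by simp
      have vi: "v i = w i" using i by (simp add: v_def max_absorb1)
      have "exp (- w i) \<le> 1 / (1 + w i)"
        using w_nonneg[OF i] exp_ge_add_one_self[of "w i"] by (simp add: exp_minus field_simps)
      moreover have "1 / (1 + w i) \<le> 1 - w i + (w i) ^ 2"
        using w_nonneg[OF i] by (simp add: field_simps power2_eq_square)
      moreover have "(w i) ^ 2 \<le> (y * real i powr (- lam)) ^ 2"
        using w_nonneg[OF i] w_bounds(2)[OF i] by (intro power_mono) auto
      moreover have "(y * real i powr (- lam)) ^ 2 = y ^ 2 * real i powr (- (2 * lam))"
        by (simp add: power_mult_distrib power2_eq_square powr_add[symmetric])
      moreover have "w i = y * real i powr (- lam) - y * B * real i powr (- (2 * lam))"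
        by (simp add: w_def algebra_simps)
      ultimately show ?thesis unfolding vi distrib_right by linarith
    qed
    have S1: "real j powr (- lam) - real j powr (- lam - 1) - H * real n powr (- lam) \<le> ?S1"
      unfolding H_def using m10 j by (intro sum_tail_weight_ge l0 int1 eq1 int2) auto
    have S2: "?S2 \<le> 2 / 3 * real j powr (- (2 * lam))"
      using m10 j lam by (intro sum_tail_weight_le) auto
    have jp: "real j powr (- lam - 1) \<le> real j powr (- (2 * lam))"
      using m10 j lam by (intro powr_mono) auto
    \<comment> \<open>This identity is the defining equation of B, multiplied by y.\<close>
    have "w j = y * real j powr (- lam) - y * real j powr (- (2 * lam))
        - (y * B + y ^ 2) * (2 / 3 * real j powr (- (2 * lam)))"
      by (simp add: w_def B_def algebra_simps power2_eq_square)
    also have "\<dots> \<le> y * real j powr (- lam) - y * real j powr (- lam - 1) - (y * B + y ^ 2) * ?S2"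
    proof (rule diff_mono[OF diff_mono[OF order_refl]])
      show "y * real j powr (- lam - 1) \<le> y * real j powr (- (2 * lam))"
        by (rule mult_left_mono[OF jp]) (use y in simp)
      show "(y * B + y ^ 2) * ?S2 \<le> (y * B + y ^ 2) * (2 / 3 * real j powr (- (2 * lam)))"
        by (rule mult_left_mono[OF S2]) (use y in \<open>simp add: B_def\<close>)
    qed
    \<comment> \<open>The choice of s cancels the boundary term at n exactly.\<close>
    also have "\<dots> = s + y * (real j powr (- lam) - real j powr (- lam - 1) - H * real n powr (- lam))
        - (y * B + y ^ 2) * ?S2"
      by (simp add: s_def algebra_simps)
    also have "\<dots> \<le> s + y * ?S1 - (y * B + y ^ 2) * ?S2"
      using mult_left_mono[OF S1, of y] y by simp
    also have "\<dots> = s + (\<Sum>i=Suc j..n. (y * real i powr (- lam) - (y * B + y ^ 2) * real i powr (- (2 * lam))) * ?G i)"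
      by (simp add: left_diff_distrib sum_subtractf sum_distrib_left mult.assoc)
    also have "\<dots> \<le> s + (\<Sum>i=Suc j..n. (1 - exp (- v i)) * ?G i)"
      by (intro add_left_mono sum_mono mult_right_mono phi tail_weight_nonneg) auto
    finally show ?thesis .
  qed
  \<comment> \<open>For j < m, the inequality at m suffices: lowering j only increases the tail
    weights and adds nonnegative terms.\<close>
  have v_sub: "v j \<le> s + (\<Sum>i=Suc j..n. (1 - exp (- v i)) * tail_weight (i - 1) j)"
    if j: "1 \<le> j" "j \<le> n" for j
  proof -
    let ?k = "max j m"
    have "v j \<le> s + (\<Sum>i=Suc ?k..n. (1 - exp (- v i)) * tail_weight (i - 1) ?k)"
      unfolding v_def[of j] using j mn by (intro w_sub) auto
    also have "\<dots> \<le> s + (\<Sum>i=Suc ?k..n. (1 - exp (- v i)) * tail_weight (i - 1) j)"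
      using v_nonneg by (intro add_left_mono sum_mono mult_left_mono tail_weight_antimono) auto
    also have "\<dots> \<le> s + (\<Sum>i=Suc j..n. (1 - exp (- v i)) * tail_weight (i - 1) j)"
      using v_nonneg tail_weight_nonneg
      by (intro add_left_mono sum_mono2) (auto intro!: mult_nonneg_nonneg)
    finally show ?thesis .
  qed
  define \<kappa> where "\<kappa> = (1 - exp (- 1 / 64 :: real)) / 2"
  have \<kappa>: "0 < \<kappa>" by (simp add: \<kappa>_def)
  \<comment> \<open>For i <= m each summand is at least (1 - exp (- 1/64)) / (2 (i - 1)), whence the
    factor 1/2 in \<kappa>.\<close>
  have "\<kappa> * ln (real m) \<le> \<kappa> * harm (m - 1)"
    using ln_le_harm[of "m - 1"] m10 \<kappa> by (intro mult_left_mono) (auto simp: of_nat_diff)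
  also have "\<dots> = (\<Sum>i=1..m-1. \<kappa> * inverse (real i))"
    by (simp add: harm_def sum_distrib_left)
  also have "\<dots> = (\<Sum>i=2..m. \<kappa> * inverse (real (i - 1)))"
    using m10 by (intro sum.reindex_bij_witness[of _ "\<lambda>i. i - 1" Suc]) auto
  also have "\<dots> \<le> (\<Sum>i=2..m. (1 - exp (- v i)) * tail_weight (i - 1) 1)"
  proof (intro sum_mono)
    fix i assume i: "i \<in> {2..m}"
    have "(1 - exp (- 1 / 64)) * (1 / (2 * real (i - 1))) \<le> (1 - exp (- v i)) * tail_weight (i - 1) 1"
      using v_ge[of i] v_nonneg[of i] i by (intro mult_mono tail_weight_1_ge) auto
    moreover have "\<kappa> * inverse r = (1 - exp (- 1 / 64)) * (1 / (2 * r))" for r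
      by (simp add: \<kappa>_def inverse_eq_divide)
    ultimately show "\<kappa> * inverse (real (i - 1)) \<le> (1 - exp (- v i)) * tail_weight (i - 1) 1"
      by (simp only:)
  qed
  also have "\<dots> \<le> (\<Sum>i=2..n. (1 - exp (- v i)) * tail_weight (i - 1) 1)"
    using v_nonneg tail_weight_nonneg mn by (intro sum_mono2) (auto intro!: mult_nonneg_nonneg)
  finally have sum_ge: "\<kappa> * ln (real m) \<le> (\<Sum>i=2..n. (1 - exp (- v i)) * tail_weight (i - 1) 1)" .
  have s: "0 \<le> s" using y H by (simp add: s_def)
  have "tree_expectation n (\<lambda>ps. exp (- s * real (tdeg ps n 1)))
    \<le> exp (- s - (\<Sum>i=2..n. (1 - exp (- v i)) * tail_weight (i - 1) 1))"
    using mn m10 by (intro laplace_root_deg_le v_sub) auto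
  also have "\<dots> \<le> exp (- \<kappa> * ln (real m))" using sum_ge s by simp
  also have "\<dots> = real m powr (- \<kappa>)" using m10 by (simp add: powr_def)
  also have "\<dots> \<le> (y powr (1 / lam)) powr (- \<kappa>)"
  proof (intro powr_mono2')
    have "y powr (1 / lam) \<le> b powr (1 / lam)" using y l0 by (intro powr_mono2) (auto simp: b_def B_def)
    then show "y powr (1 / lam) \<le> real m" using m by linarith
  qed (use \<kappa> y in auto)
  also have "\<dots> = y powr (- (\<kappa> / lam))" by (simp add: powr_powr)
  finally show ?thesis unfolding s_def \<kappa>_def by simp
qed

text \<open>Exponential Markov inequality with s x n^lam = 1, which fixes y = 1 / (x H) and costs a
  factor e. For y < 1 the bound exceeds 1 and is trivial.\<close>

lemma root_deg_lower_tail: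
  assumes lam: "1 / 2 \<le> lam" "lam < 1"
    and int1: "integrable \<mu> (\<lambda>\<xi>. (1 - \<xi>) powr (lam - 1))"
    and eq1: "(LINT \<xi>|\<mu>. (1 - \<xi>) powr (lam - 1)) = 2 * lam"
    and int2: "integrable \<mu> (\<lambda>\<xi>. 1 / (1 - \<xi>))"
  shows "\<exists>C1>0. \<exists>C2>0. \<forall>x>0.
    limsup (\<lambda>n. ereal (tree_event_prob \<mu> n (\<lambda>ps. real (root_deg ps) < x * real n powr lam)))
      \<le> ereal (C1 * x powr C2)"
proof -
  define H where "H = (LINT \<xi>|\<mu>. 1 / (1 - \<xi>)) / (2 * lam)"
  define p where "p = (1 - exp (- 1 / 64 :: real)) / 2 / lam"
  have p: "0 < p" using lam by (simp add: p_def)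
  have H: "0 < H"
  proof -
    have "(LINT \<xi>|\<mu>. 1) \<le> (LINT \<xi>|\<mu>. 1 / (1 - \<xi>))"
      using support by (intro integral_mono_AE int2) (auto simp: field_simps)
    then show ?thesis using lam prob_space by (simp add: H_def)
  qed
  have main: "limsup (\<lambda>n. ereal (tree_event_prob \<mu> n (\<lambda>ps. real (root_deg ps) < x * real n powr lam)))
      \<le> ereal (exp 1 * H powr p * x powr p)" if x: "0 < x" for x
  proof -
    define y where "y = 1 / (x * H)"
    have y: "0 < y" using x H by (simp add: y_def)
    have yp: "y powr (- p) = H powr p * x powr p"
      using x H by (simp add: y_def powr_minus powr_divide powr_mult field_simps)
    define N where "N = max 1 (nat \<lceil>(4 * (3 + 2 * y)) powr (1 / lam)\<rceil>)"
    show ?thesis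
    proof (intro Limsup_bounded eventually_sequentiallyI[of N])
      fix n assume "N \<le> n"
      then have n: "1 \<le> n" "nat \<lceil>(4 * (3 + 2 * y)) powr (1 / lam)\<rceil> \<le> n" by (auto simp: N_def)
      let ?P = "tree_event_prob \<mu> n (\<lambda>ps. real (root_deg ps) < x * real n powr lam)"
      have "?P \<le> exp 1 * y powr (- p)"
      proof (cases "1 \<le> y")
        case True
        define s where "s = y * H * real n powr (- lam)"
        have s: "s * (x * real n powr lam) = 1" "0 < s"
          using x H n y by (auto simp: s_def y_def powr_minus)
        have "?P \<le> tree_expectation n (\<lambda>ps. exp 1 * exp (- s * real (tdeg ps n 1)))"
        proof (intro tree_event_prob_le n)
          fix ps assume ps: "ps \<in> tree_lists n" and "real (root_deg ps) < x * real n powr lam"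
          then have "s * real (tdeg ps n 1) \<le> s * (x * real n powr lam)"
            using s n by (intro mult_left_mono) (auto simp: root_deg_tree_lists)
          then show "1 \<le> exp 1 * exp (- s * real (tdeg ps n 1))"
            using s by (simp add: exp_add[symmetric])
        qed simp
        also have "\<dots> = exp 1 * tree_expectation n (\<lambda>ps. exp (- s * real (tdeg ps n 1)))"
          by (rule tree_expectation_cmult)
        also have "\<dots> \<le> exp 1 * y powr (- p)"
          unfolding s_def p_def
          by (intro mult_left_mono laplace_root_deg_power_bound lam True int1 eq1 int2 H_def H n) auto
        finally show ?thesis .
      next
        case False
        then have "y powr p \<le> 1" using powr_mono2[of p y 1] y p by simp
        then have "1 \<le> y powr (- p)" using y by (simp add: powr_minus field_simps)
        then have "1 * 1 \<le> exp 1 * y powr (- p)" by (intro mult_mono) auto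
        then show ?thesis
          using tree_event_prob_le_1[OF n(1), of "\<lambda>ps. real (root_deg ps) < x * real n powr lam"] by simp
      qed
      then show "ereal ?P \<le> ereal (exp 1 * H powr p * x powr p)" by (simp add: yp mult.assoc)
    qed
  qed
  show ?thesis
    using main p H by (intro exI[of _ "exp 1 * H powr p"] conjI exI[of _ p]) auto
qed

end

subsection \<open>The equation for lambda\<close>

lemma eta_of_measurable [measurable]: "eta_of \<in> borel_measurable borel"
  unfolding eta_of_def[abs_def] by measurable

text \<open>Tonelli: integrating over t >= u first gives exp (- lam u) / lam. The defining equation
  of lambda becomes E[exp ((1 - lam) eta)] = 2 lam.\<close>

lemma nn_integral_exp_hfun:
  fixes \<mu> :: "real measure"
  assumes "prob_space \<mu>" and [measurable_cong]: "sets \<mu> = sets borel" and lam: "0 < lam"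
  shows "(\<integral>\<^sup>+t\<in>{0..}. ennreal (exp (- lam * t) * hfun \<mu> t) \<partial>lborel)
    = (\<integral>\<^sup>+\<xi>. ennreal (exp ((1 - lam) * eta_of \<xi>) / (2 * lam)) * indicator {0..} (eta_of \<xi>) \<partial>\<mu>)"
proof -
  define M where "M = distr \<mu> borel eta_of"
  interpret \<mu>: prob_space \<mu> by fact
  interpret M: prob_space M unfolding M_def by (rule \<mu>.prob_space_distr) measurable
  have sM [measurable_cong]: "sets M = sets borel" by (simp add: M_def)
  interpret pair_sigma_finite lborel M ..
  have h: "ennreal (exp (- lam * t) * hfun \<mu> t) * indicator {0..} t
    = (\<integral>\<^sup>+u. ennreal (exp u / 2) * (ennreal (exp (- lam * t)) * indicator {u..} t) * indicator {0..} u \<partial>M)"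
    for t
  proof -
    \<comment> \<open>For fixed t the integrand is bounded by exp t, so the integral in
      \<open>hfun\<close> agrees with the nonnegative one.\<close>
    have "integrable M (\<lambda>u. indicator {0..t} u * exp u)"
      by (rule M.integrable_const_bound[of _ "exp t"]) (auto simp: indicator_def)
    then have "(\<integral>\<^sup>+u. ennreal (indicator {0..t} u * exp u) \<partial>M) = ennreal (LINT u|M. indicator {0..t} u * exp u)"
      by (rule nn_integral_eq_integral) auto
    then have "ennreal (exp (- lam * t) * hfun \<mu> t)
      = ennreal (exp (- lam * t) / 2) * (\<integral>\<^sup>+u. ennreal (indicator {0..t} u * exp u) \<partial>M)"
      unfolding hfun_def M_def[symmetric] by (simp add: ennreal_mult'[symmetric])
    also have "\<dots> * indicator {0..} t
      = (\<integral>\<^sup>+u. ennreal (exp (- lam * t) / 2) * ennreal (indicator {0..t} u * exp u) * indicator {0..} t \<partial>M)"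
      by (simp add: nn_integral_cmult nn_integral_multc)
    also have "\<dots> = (\<integral>\<^sup>+u. ennreal (exp u / 2) * (ennreal (exp (- lam * t)) * indicator {u..} t) * indicator {0..} u \<partial>M)"
      by (intro nn_integral_cong) (auto simp: indicator_def ennreal_mult'[symmetric] mult.commute)
    finally show ?thesis .
  qed
  have inner: "(\<integral>\<^sup>+t. ennreal (exp (- lam * t)) * indicator {u..} t \<partial>lborel) = ennreal (exp (- lam * u) / lam)" for u
  proof -
    have "((\<lambda>t. - exp (- lam * t) / lam) \<longlongrightarrow> - 0 / lam) at_top"
    proof (intro tendsto_intros filterlim_compose[OF exp_at_bot])
      show "filterlim (\<lambda>t. - lam * t) at_bot at_top"
        using filterlim_tendsto_neg_mult_at_bot[OF tendsto_const, of "- lam" "\<lambda>t. t"] lam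
        by (simp add: filterlim_ident)
    qed (use lam in auto)
    then have lim: "((\<lambda>t. - exp (- lam * t) / lam) \<longlongrightarrow> 0) at_top" by simp
    have "(\<integral>\<^sup>+t. ennreal (exp (- lam * t)) * indicator {u..} t \<partial>lborel) = ennreal (0 - (- exp (- lam * u) / lam))"
      using lam by (intro nn_integral_FTC_atLeast[OF _ _ _ lim]) (auto intro!: derivative_eq_intros)
    then show ?thesis by simp
  qed
  have "(\<integral>\<^sup>+t\<in>{0..}. ennreal (exp (- lam * t) * hfun \<mu> t) \<partial>lborel)
    = (\<integral>\<^sup>+t. (\<integral>\<^sup>+u. ennreal (exp u / 2) * (ennreal (exp (- lam * t)) * indicator {u..} t) * indicator {0..} u \<partial>M) \<partial>lborel)"
    by (intro nn_integral_cong h)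
  also have "\<dots> = (\<integral>\<^sup>+u. (\<integral>\<^sup>+t. ennreal (exp u / 2) * (ennreal (exp (- lam * t)) * indicator {u..} t) * indicator {0..} u \<partial>lborel) \<partial>M)"
  proof (rule Fubini'[symmetric])
    have [measurable]: "Measurable.pred (lborel \<Otimes>\<^sub>M M) (\<lambda>x. fst x \<in> {snd x..})"
      unfolding atLeast_iff by measurable
    show "(\<lambda>(t, u). ennreal (exp u / 2) * (ennreal (exp (- lam * t)) * indicator {u..} t) * indicator {0..} u)
        \<in> borel_measurable (lborel \<Otimes>\<^sub>M M)"
      unfolding case_prod_beta by measurable
  qed
  also have "\<dots> = (\<integral>\<^sup>+u. ennreal (exp ((1 - lam) * u) / (2 * lam)) * indicator {0..} u \<partial>M)"
  proof (intro nn_integral_cong)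
    fix u
    have "(\<integral>\<^sup>+t. ennreal (exp u / 2) * (ennreal (exp (- lam * t)) * indicator {u..} t) * indicator {0..} u \<partial>lborel)
      = ennreal (exp u / 2) * ennreal (exp (- lam * u) / lam) * indicator {0..} u"
      by (simp add: nn_integral_cmult nn_integral_multc inner[simplified])
    also have "ennreal (exp u / 2) * ennreal (exp (- lam * u) / lam) = ennreal (exp ((1 - lam) * u) / (2 * lam))"
      using lam by (simp add: ennreal_mult'[symmetric] exp_add[symmetric] algebra_simps)
    finally show "(\<integral>\<^sup>+t. ennreal (exp u / 2) * (ennreal (exp (- lam * t)) * indicator {u..} t) * indicator {0..} u \<partial>lborel)
      = ennreal (exp ((1 - lam) * u) / (2 * lam)) * indicator {0..} u" .
  qed
  also have "\<dots> = (\<integral>\<^sup>+\<xi>. ennreal (exp ((1 - lam) * eta_of \<xi>) / (2 * lam)) * indicator {0..} (eta_of \<xi>) \<partial>\<mu>)"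
    unfolding M_def by (intro nn_integral_distr) measurable
  finally show ?thesis .
qed

section \<open>Reduction of the assumptions to moments of 1 - xi\<close>

theorem theorem4p11:
  fixes \<mu> :: "real measure" and f :: "real \<Rightarrow> real" and lam :: real
  assumes mu_prob: "prob_space \<mu>" and mu_sets: "sets \<mu> = sets borel"
    and mu_supp: "AE \<xi> in \<mu>. 0 \<le> \<xi> \<and> \<xi> \<le> 1"
    and mu_nondeg: "measure \<mu> {0} < 1"
    and f_meas: "f \<in> borel_measurable borel"
    and f_nonneg: "\<And>u. 0 \<le> f u" and f_zero: "\<And>u. u < 0 \<Longrightarrow> f u = 0"
    and f_density: "distr \<mu> borel eta_of = density lborel (\<lambda>u. ennreal (f u))"
    and f_bound: "\<exists>B. \<forall>u\<ge>0. exp u * f u \<le> B"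
    and A_mgf: "\<exists>\<theta>>0. (\<integral>\<^sup>+\<xi>. ennreal (exp (\<theta> * eta_of \<xi>)) \<partial>\<mu>) < \<infinity>"
    and A_lambda_pos: "lam > 0"
    and A_lambda: "(\<integral>\<^sup>+t\<in>{0..}. ennreal (exp (- lam * t) * hfun \<mu> t) \<partial>lborel) = 1"
    and A_lambda_unique: "\<And>l. l > 0 \<Longrightarrow>
          (\<integral>\<^sup>+t\<in>{0..}. ennreal (exp (- l * t) * hfun \<mu> t) \<partial>lborel) = 1 \<Longrightarrow> l = lam"
    and A_xlogx: "\<exists>(M::'w measure) N. is_ppp M N (hfun \<mu>) \<and>
          (\<integral>\<^sup>+\<omega>. xlogplus (\<integral>\<^sup>+t. ennreal (exp (- lam * t)) \<partial>(N \<omega>)) \<partial>M) < \<infinity>"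
  shows
    "((\<forall>\<gamma>>0. (\<integral>\<^sup>+\<xi>. ennreal (exp (\<gamma> * eta_of \<xi>)) \<partial>\<mu>) < \<infinity>) \<longrightarrow>
       (\<exists>C1>0. \<forall>A>0.
          limsup (\<lambda>n. ereal (tree_event_prob \<mu> n
                     (\<lambda>ps. real (root_deg ps) > A * real n powr lam)))
            \<le> ereal (C1 / A powr (1 / (lam + 1))))) \<and>
     ((\<exists>\<gamma>>1. (\<integral>\<^sup>+\<xi>. ennreal (exp (\<gamma> * eta_of \<xi>)) \<partial>\<mu>) < \<infinity>) \<longrightarrow>
       (\<exists>C1>0. \<exists>C2>0. \<forall>x>0.
          limsup (\<lambda>n. ereal (tree_event_prob \<mu> n
                     (\<lambda>ps. real (root_deg ps) < x * real n powr lam)))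
            \<le> ereal (C1 * x powr C2)))"
proof -
  interpret prob_space \<mu> by fact
  note [measurable_cong] = mu_sets
  have "AE u in distr \<mu> borel eta_of. u \<noteq> 0"
    unfolding f_density using f_meas AE_lborel_singleton[of 0] by (subst AE_density) auto
  then have "AE \<xi> in \<mu>. eta_of \<xi> \<noteq> 0"
    by (subst (asm) AE_distr_iff) auto
  then have supp: "AE \<xi> in \<mu>. 0 < \<xi> \<and> \<xi> < 1"
    using mu_supp
  proof eventually_elim
    case (elim \<xi>)
    \<comment> \<open>As \<open>ln 0 = 0\<close> by convention, \<open>eta_of\<close> vanishes at 1
      as well as at 0, so the missing atom of eta at 0 excludes both endpoints.\<close>
    then have "\<xi> \<noteq> 0" "\<xi> \<noteq> 1" by (auto simp: eta_of_def)
    then show ?case using elim by auto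
  qed
  interpret delay_distribution \<mu> by unfold_locales (fact mu_sets supp)+
  have exp_eta: "exp (g * eta_of \<xi>) = (1 - \<xi>) powr (- g)" if "\<xi> < 1" for g \<xi>
    using that by (simp add: eta_of_def powr_def)
  have "(\<integral>\<^sup>+\<xi>. ennreal ((1 - \<xi>) powr (lam - 1)) * ennreal (1 / (2 * lam)) \<partial>\<mu>)
    = (\<integral>\<^sup>+\<xi>. ennreal (exp ((1 - lam) * eta_of \<xi>) / (2 * lam)) * indicator {0..} (eta_of \<xi>) \<partial>\<mu>)"
  proof (intro nn_integral_cong_AE)
    show "AE \<xi> in \<mu>. ennreal ((1 - \<xi>) powr (lam - 1)) * ennreal (1 / (2 * lam))
      = ennreal (exp ((1 - lam) * eta_of \<xi>) / (2 * lam)) * indicator {0..} (eta_of \<xi>)"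
      using supp
    proof eventually_elim
      case (elim \<xi>)
      then have "0 \<le> eta_of \<xi>" by (simp add: eta_of_def)
      then show ?case using elim by (simp add: exp_eta ennreal_mult'[symmetric])
    qed
  qed
  also have "\<dots> = 1"
    using nn_integral_exp_hfun[OF mu_prob mu_sets A_lambda_pos] A_lambda by simp
  finally have "ennreal (2 * lam) * ((\<integral>\<^sup>+\<xi>. ennreal ((1 - \<xi>) powr (lam - 1)) \<partial>\<mu>) * ennreal (1 / (2 * lam)))
    = ennreal (2 * lam)"
    by (simp add: nn_integral_multc)
  moreover have "ennreal (2 * lam) * (a * ennreal (1 / (2 * lam))) = a" for a
    using A_lambda_pos by (simp add: mult.left_commute ennreal_mult'[symmetric])
  ultimately have nn: "(\<integral>\<^sup>+\<xi>. ennreal ((1 - \<xi>) powr (lam - 1)) \<partial>\<mu>) = ennreal (2 * lam)"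
    by simp
  have int1: "integrable \<mu> (\<lambda>\<xi>. (1 - \<xi>) powr (lam - 1))"
    using nn by (intro integrableI_nonneg) auto
  have eq1: "(LINT \<xi>|\<mu>. (1 - \<xi>) powr (lam - 1)) = 2 * lam"
    using nn A_lambda_pos by (intro integral_eq_nn_integral[THEN trans]) auto
  \<comment> \<open>For lam >= 1 the integrand is at most 1, but its mean is 2 lam >= 2.\<close>
  have lam1: "lam < 1"
  proof (rule ccontr)
    assume "\<not> lam < 1"
    then have "AE \<xi> in \<mu>. (1 - \<xi>) powr (lam - 1) \<le> 1"
      using powr_mono2[of "lam - 1" _ 1] by (intro eventually_mono[OF supp]) auto
    then have "(LINT \<xi>|\<mu>. (1 - \<xi>) powr (lam - 1)) \<le> (LINT \<xi>|\<mu>. 1)"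
      by (intro integral_mono_AE int1) auto
    then show False using eq1 \<open>\<not> lam < 1\<close> prob_space by simp
  qed
  \<comment> \<open>Now the exponent is negative, so the integrand is at least 1 and so is its mean
    2 lam.\<close>
  have lam2: "1 / 2 \<le> lam"
  proof -
    have "AE \<xi> in \<mu>. 1 \<le> (1 - \<xi>) powr (lam - 1)"
      using powr_mono2'[of "lam - 1" _ 1] lam1 by (intro eventually_mono[OF supp]) auto
    then have "(LINT \<xi>|\<mu>. 1) \<le> (LINT \<xi>|\<mu>. (1 - \<xi>) powr (lam - 1))"
      by (intro integral_mono_AE int1) auto
    then show ?thesis using eq1 prob_space by simp
  qed
  have moment: "integrable \<mu> (\<lambda>\<xi>. (1 - \<xi>) powr (- g))"
    if "(\<integral>\<^sup>+\<xi>. ennreal (exp (g * eta_of \<xi>)) \<partial>\<mu>) < \<infinity>" for g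
  proof (intro integrableI_nonneg)
    have "(\<integral>\<^sup>+\<xi>. ennreal ((1 - \<xi>) powr (- g)) \<partial>\<mu>) = (\<integral>\<^sup>+\<xi>. ennreal (exp (g * eta_of \<xi>)) \<partial>\<mu>)"
    proof (rule nn_integral_cong_AE, rule eventually_mono[OF supp])
      show "ennreal ((1 - \<xi>) powr (- g)) = ennreal (exp (g * eta_of \<xi>))" if "0 < \<xi> \<and> \<xi> < 1" for \<xi>
        using that exp_eta[of \<xi> g] by simp
    qed
    then show "(\<integral>\<^sup>+\<xi>. ennreal ((1 - \<xi>) powr (- g)) \<partial>\<mu>) < \<infinity>" using that by simp
  qed auto
  show ?thesis
  proof (intro conjI impI)
    assume "\<forall>\<gamma>>0. (\<integral>\<^sup>+\<xi>. ennreal (exp (\<gamma> * eta_of \<xi>)) \<partial>\<mu>) < \<infinity>"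
    then have "integrable \<mu> (\<lambda>\<xi>. (1 - \<xi>) powr (lam - 2))"
      using moment[of "2 - lam"] lam1 by simp
    from mean_root_deg_bound[OF A_lambda_pos lam1 int1 eq1 this]
    obtain C where C: "0 < C" "\<And>n. 1 \<le> n \<Longrightarrow> mean_root_deg n \<le> C * real n powr lam" by blast
    show "\<exists>C1>0. \<forall>A>0.
          limsup (\<lambda>n. ereal (tree_event_prob \<mu> n
                     (\<lambda>ps. real (root_deg ps) > A * real n powr lam)))
            \<le> ereal (C1 / A powr (1 / (lam + 1)))"
      using root_deg_upper_tail[OF C A_lambda_pos] C(1) by (intro exI[of _ "C + 1"]) auto
  next
    assume "\<exists>\<gamma>>1. (\<integral>\<^sup>+\<xi>. ennreal (exp (\<gamma> * eta_of \<xi>)) \<partial>\<mu>) < \<infinity>"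
    then obtain g where g: "1 < g" "integrable \<mu> (\<lambda>\<xi>. (1 - \<xi>) powr (- g))" using moment by blast
    have "integrable \<mu> (\<lambda>\<xi>. 1 / (1 - \<xi>))"
    proof (rule Bochner_Integration.integrable_bound[OF g(2)])
      show "AE \<xi> in \<mu>. norm (1 / (1 - \<xi>)) \<le> norm ((1 - \<xi>) powr (- g))"
        using supp
      proof eventually_elim
        case (elim \<xi>)
        have "(1 - \<xi>) powr (- 1) \<le> (1 - \<xi>) powr (- g)"
          using elim g by (intro powr_mono') auto
        then show ?case using elim by (simp add: powr_minus_divide)
      qed
    qed auto
    from root_deg_lower_tail[OF lam2 lam1 int1 eq1 this]
    show "\<exists>C1>0. \<exists>C2>0. \<forall>x>0.
          limsup (\<lambda>n. ereal (tree_event_prob \<mu> n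
                     (\<lambda>ps. real (root_deg ps) < x * real n powr lam)))
            \<le> ereal (C1 * x powr C2)" .
  qed
qed

end
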